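(* Let $\gamma,\tau>0$ and consider the Stochastic PD3O algorithm: given $p^0\in\mathcal{X}$, $y^0\in\mathcal{Y}$, for $k=0,1,2,\dots$ $$\begin{aligned} x^k&=\mathrm{prox}_{\gamma R}(p^k),\\ w^k&=2x^k-p^k-\gamma g^{k+1},\\ y^{k+1}&=\mathrm{prox}_{\tau H^*}\big(y^k+\tau L(w^k-\gamma L^*y^k)\big),\\ p^{k+1}&=x^k-\gamma g^{k+1}-\gamma L^*y^{k+1},\end{aligned}$$ where $(g^k)$ satisfies the Stochastic Gradient Assumption (see context) with constants $\alpha,\beta,\delta\ge0$, $\rho\in(0,1]$ and process $(\sigma_k)$. Let $\kappa:=\beta/\rho$ and suppose that $\gamma\le \frac{1}{2(\alpha+\kappa\delta)}$ and $\gamma\tau\|L\|^2<1$. Set $V^0:=\|v^0-v^\star\|_P^2+\gamma^2\kappa\sigma_0^2$, where $v^0=(p^0,y^0)$. Then, for every integer $k\ge1$, $$\mathbb{E}\big(\mathscr{L}(\bar x^k,y^\star)-\mathscr{L}(x^\star,\bar y^{k+1})\big)\le\frac{V^0}{k\gamma},$$ where $\bar x^k=\frac1k\sum_{j=0}^{k-1}x^j$ and $\bar y^{k+1}=\frac1k\sum_{j=1}^{k}y^j$.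
   Context: $\mathcal{X},\mathcal{Y}$ are finite-dimensional real Hilbert spaces, $L:\mathcal{X}\to\mathcal{Y}$ is a linear operator with adjoint $L^*$ and operator norm $\|L\|$. $F:\mathcal{X}\to\mathbb{R}$ is convex and $\nu$-smooth for some $\nu>0$ (differentiable with $\nu$-Lipschitz gradient). $R:\mathcal{X}\to\mathbb{R}\cup\{+\infty\}$ and $H:\mathcal{Y}\to\mathbb{R}\cup\{+\infty\}$ are proper, convex, lower semicontinuous. $G^*$ is the convex conjugate and $\mathrm{prox}_G(z)=\arg\min_{z'}\{G(z')+\tfrac12\|z-z'\|^2\}$. Standing assumption: there exists $(x^\star,y^\star)\in\mathcal{X}\times\mathcal{Y}$ with $0\in\nabla F(x^\star)+\partial R(x^\star)+L^*y^\star$ and $Lx^\star\in\partial H^*(y^\star)$; such a pair is fixed. Lagrangian: $\mathscr{L}(x,y)=F(x)+R(x)-H^*(y)+\langle Lx,y\rangle$. $v^\star=(p^\star,y^\star)$ with $p^\star=x^\star-\gamma\nabla F(x^\star)-\gamma L^*y^\star$ (the fixed point of the iteration associated with $(x^\star,y^\star)$). The norm $\|\cdot\|_P$ on $\mathcal{X}\times\mathcal{Y}$ is $\|(x,y)\|_P^2=\|x\|^2+\frac{\gamma}{\tau}\|y\|^2-\gamma^2\|L^*y\|^2$. Bregman divergence: $D_F(x,x')=F(x)-F(x')-\langle\nabla F(x'),x-x'\rangle$. Stochastic Gradient Assumption: on a filtered probability space $(\Omega,\mathscr{F},(\mathscr{F}_k)_{k\in\mathbb{N}},\mathbb{P})$,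 with $\mathbb{E}_k$ the conditional expectation given $\mathscr{F}_k$, $(g^k)$ is an $(\mathscr{F}_k)$-adapted $\mathcal{X}$-valued process and there exist $\alpha,\beta,\delta\ge0$, $\rho\in(0,1]$ and a real $(\mathscr{F}_k)$-adapted process $(\sigma_k)_{k\in\mathbb{N}}$ such that for every $k\in\mathbb{N}$: $\mathbb{E}_k(g^{k+1})=\nabla F(x^k)$; $\mathbb{E}_k\|g^{k+1}-\nabla F(x^\star)\|^2\le2\alpha D_F(x^k,x^\star)+\beta\sigma_k^2$; $\mathbb{E}_k(\sigma_{k+1}^2)\le(1-\rho)\sigma_k^2+2\delta D_F(x^k,x^\star)$, where $x^k$ are the iterates of the algorithm. The initial data $p^0,y^0,\sigma_0$ are deterministic. *)

theory Defs
  imports "HOL-Probability.Probability"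
begin

definition proper :: "('a \<Rightarrow> ereal) \<Rightarrow> bool" where
  "proper f \<longleftrightarrow> (\<forall>x. f x \<noteq> -\<infinity>) \<and> (\<exists>x. f x \<noteq> \<infinity>)"

text \<open>At the endpoints \<open>t = 0, 1\<close> this relies on \<open>0 * \<infinity> = 0\<close> in \<^typ>\<open>ereal\<close>;
  the value \<open>-\<infinity>\<close> is excluded separately by \<^const>\<open>proper\<close>.\<close>

definition econvex :: "('a::real_vector \<Rightarrow> ereal) \<Rightarrow> bool" where
  "econvex f \<longleftrightarrow>
     (\<forall>x y. \<forall>t\<in>{0..1}. f ((1 - t) *\<^sub>R x + t *\<^sub>R y) \<le> ereal (1 - t) * f x + ereal t * f y)"

definition lsc :: "('a::topological_space \<Rightarrow> ereal) \<Rightarrow> bool" where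
  "lsc f \<longleftrightarrow> (\<forall>x. f x \<le> Liminf (nhds x) f)"

definition conjugate :: "('a::real_inner \<Rightarrow> ereal) \<Rightarrow> 'a \<Rightarrow> ereal" where
  "conjugate f y = (SUP x. ereal (y \<bullet> x) - f x)"

definition subdifferential :: "('a::real_inner \<Rightarrow> ereal) \<Rightarrow> 'a \<Rightarrow> 'a set" where
  "subdifferential f x = {u. \<forall>z. f x + ereal (u \<bullet> (z - x)) \<le> f z}"

definition prox :: "('a::real_inner \<Rightarrow> ereal) \<Rightarrow> 'a \<Rightarrow> 'a" where
  "prox f z = (ARG_MIN (\<lambda>z'. f z' + ereal (1 / 2 * (norm (z - z'))\<^sup>2)) z'. True)"

definition grad :: "('a::real_inner \<Rightarrow> real) \<Rightarrow> 'a \<Rightarrow> 'a" where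
  "grad F x = (THE D. GDERIV F x :> D)"

definition smooth_with :: "real \<Rightarrow> ('a::real_inner \<Rightarrow> real) \<Rightarrow> bool" where
  "smooth_with \<nu> F \<longleftrightarrow> (\<forall>x. F differentiable (at x)) \<and> \<nu>-lipschitz_on UNIV (grad F)"

definition bregman :: "('a::real_inner \<Rightarrow> real) \<Rightarrow> 'a \<Rightarrow> 'a \<Rightarrow> real" where
  "bregman F x x' = F x - F x' - grad F x' \<bullet> (x - x')"

text \<open>Only meaningful when \<^term>\<open>R x\<close> and \<^term>\<open>conjugate H y\<close> are not both \<open>\<infinity>\<close>:
  in \<^typ>\<open>ereal\<close> one has \<open>\<infinity> - \<infinity> = \<infinity>\<close>.\<close>

definition lagrangian ::
  "('a::real_inner \<Rightarrow> real) \<Rightarrow> ('a \<Rightarrow> ereal) \<Rightarrow> ('b::real_inner \<Rightarrow> ereal) \<Rightarrow> ('a \<Rightarrow> 'b) \<Rightarrow> 'a \<Rightarrow> 'b \<Rightarrow> ereal"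
  where "lagrangian F R H L x y = ereal (F x) + R x - conjugate H y + ereal (L x \<bullet> y)"

definition primal_dual_solution ::
  "('a::real_inner \<Rightarrow> real) \<Rightarrow> ('a \<Rightarrow> ereal) \<Rightarrow> ('b::real_inner \<Rightarrow> ereal) \<Rightarrow> ('a \<Rightarrow> 'b) \<Rightarrow> 'a \<Rightarrow> 'b \<Rightarrow> bool"
  where "primal_dual_solution F R H L x y \<longleftrightarrow>
    0 \<in> (\<lambda>r. grad F x + r + adjoint L y) ` subdifferential R x \<and>
    L x \<in> subdifferential (conjugate H) y"

definition normP_sq ::
  "real \<Rightarrow> real \<Rightarrow> ('a::real_inner \<Rightarrow> 'b::real_inner) \<Rightarrow> 'a \<times> 'b \<Rightarrow> real"
  where "normP_sq \<gamma> \<tau> L v =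
    (norm (fst v))\<^sup>2 + \<gamma> / \<tau> * (norm (snd v))\<^sup>2 - \<gamma>\<^sup>2 * (norm (adjoint L (snd v)))\<^sup>2"

definition pd3o_iterates ::
  "real \<Rightarrow> real \<Rightarrow> ('a::real_inner \<Rightarrow> ereal) \<Rightarrow> ('b::real_inner \<Rightarrow> ereal) \<Rightarrow> ('a \<Rightarrow> 'b) \<Rightarrow> 'a \<Rightarrow> 'b \<Rightarrow>
    (nat \<Rightarrow> 'a) \<Rightarrow> (nat \<Rightarrow> 'a) \<Rightarrow> (nat \<Rightarrow> 'a) \<Rightarrow> (nat \<Rightarrow> 'b) \<Rightarrow> (nat \<Rightarrow> 'a) \<Rightarrow> bool"
  where "pd3o_iterates \<gamma> \<tau> R H L p0 y0 g x w y p \<longleftrightarrow>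
    p 0 = p0 \<and> y 0 = y0 \<and>
    (\<forall>k. x k = prox (\<lambda>z. ereal \<gamma> * R z) (p k) \<and>
         w k = 2 *\<^sub>R x k - p k - \<gamma> *\<^sub>R g (Suc k) \<and>
         y (Suc k) = prox (\<lambda>z. ereal \<tau> * conjugate H z)
                       (y k + \<tau> *\<^sub>R L (w k - \<gamma> *\<^sub>R adjoint L (y k))) \<and>
         p (Suc k) = x k - \<gamma> *\<^sub>R g (Suc k) - \<gamma> *\<^sub>R adjoint L (y (Suc k)))"

definition filtered_prob_space :: "'w measure \<Rightarrow> (nat \<Rightarrow> 'w measure) \<Rightarrow> bool" where
  "filtered_prob_space M \<F> \<longleftrightarrow>
     prob_space M \<and> filtration (space M) \<F> \<and> (\<forall>k. subalgebra M (\<F> k))"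

definition adapted :: "(nat \<Rightarrow> 'w measure) \<Rightarrow> (nat \<Rightarrow> 'w \<Rightarrow> 'a::topological_space) \<Rightarrow> bool" where
  "adapted \<F> X \<longleftrightarrow> (\<forall>k. X k \<in> borel_measurable (\<F> k))"

definition vec_cond_exp ::
  "'w measure \<Rightarrow> 'w measure \<Rightarrow> ('w \<Rightarrow> 'a::euclidean_space) \<Rightarrow> 'w \<Rightarrow> 'a" where
  "vec_cond_exp M N X \<omega> = (\<Sum>b\<in>Basis. real_cond_exp M N (\<lambda>\<omega>. X \<omega> \<bullet> b) \<omega> *\<^sub>R b)"

text \<open>The conditional expectations of the two nonnegative quantities are taken in
  \<^typ>\<open>ennreal\<close>, so no integrability has to be assumed. For convex \<^term>\<open>F\<close> the Bregman
  divergence is nonnegative, so \<^const>\<open>ennreal\<close> does not truncate the right-hand sides.\<close>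

definition stochastic_gradient_assumption ::
  "'w measure \<Rightarrow> (nat \<Rightarrow> 'w measure) \<Rightarrow> ('a::euclidean_space \<Rightarrow> real) \<Rightarrow> 'a \<Rightarrow>
    (nat \<Rightarrow> 'w \<Rightarrow> 'a) \<Rightarrow> (nat \<Rightarrow> 'w \<Rightarrow> 'a) \<Rightarrow> (nat \<Rightarrow> 'w \<Rightarrow> real) \<Rightarrow>
    real \<Rightarrow> real \<Rightarrow> real \<Rightarrow> real \<Rightarrow> bool"
  where "stochastic_gradient_assumption M \<F> F xstar x g \<sigma> \<alpha> \<beta> \<delta> \<rho> \<longleftrightarrow>
    adapted \<F> g \<and> adapted \<F> \<sigma> \<and>
    \<alpha> \<ge> 0 \<and> \<beta> \<ge> 0 \<and> \<delta> \<ge> 0 \<and> 0 < \<rho> \<and> \<rho> \<le> 1 \<and>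
    (\<forall>k.
      (AE \<omega> in M. vec_cond_exp M (\<F> k) (g (Suc k)) \<omega> = grad F (x k \<omega>)) \<and>
      (AE \<omega> in M. nn_cond_exp M (\<F> k) (\<lambda>\<omega>. ennreal ((norm (g (Suc k) \<omega> - grad F xstar))\<^sup>2)) \<omega>
         \<le> ennreal (2 * \<alpha> * bregman F (x k \<omega>) xstar + \<beta> * (\<sigma> k \<omega>)\<^sup>2)) \<and>
      (AE \<omega> in M. nn_cond_exp M (\<F> k) (\<lambda>\<omega>. ennreal ((\<sigma> (Suc k) \<omega>)\<^sup>2)) \<omega>
         \<le> ennreal ((1 - \<rho>) * (\<sigma> k \<omega>)\<^sup>2 + 2 * \<delta> * bregman F (x k \<omega>) xstar)))"

end

theory Submission
  imports Defs
begin

text \<open>Write \<open>p = x + \<gamma> r\<close> with \<open>r\<close> a subgradient of \<open>R\<close> at \<open>x\<close>, and let \<open>v\<close>, \<open>v'\<close> be consecutive iterates. An exact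
  identity for the \<open>P\<close>-norm shows that one step satisfies
  \<open>\<parallel>v' - v\<^sup>\<star>\<parallel>\<^sup>2 + 2 \<gamma> gap \<le> \<parallel>v - v\<^sup>\<star>\<parallel>\<^sup>2 + \<gamma>\<^sup>2 \<parallel>g - \<nabla>F x\<^sup>\<star>\<parallel>\<^sup>2 - 2 \<gamma> \<langle>g - \<nabla>F x, x - x\<^sup>\<star>\<rangle>\<close>.
  The last term has mean zero. The stochastic gradient assumption bounds the one before it by \<open>D\<^sub>F(x, x\<^sup>\<star>)\<close> and
  \<open>\<sigma>\<^sup>2\<close> terms; the latter telescope once \<open>\<gamma>\<^sup>2 \<kappa> \<sigma>\<^sup>2\<close> is added to the energy, and by the step size condition the
  former are at most \<open>\<gamma> D\<^sub>F(x, x\<^sup>\<star>) \<le> \<gamma> gap\<close>. So half of the gap survives, and summation and Jensen's inequality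
  give the bound. Square integrability propagates along the same inequality.\<close>

section \<open>Epigraphs, conjugates and subgradients\<close>

text \<open>Lower semicontinuity and convexity are used below through the epigraph. Its closedness
  and convexity pass to positive multiples and hold for conjugates by plain set arguments, which
  spares most \<open>ereal\<close> arithmetic.\<close>

definition epi :: "('a \<Rightarrow> ereal) \<Rightarrow> ('a \<times> real) set" where
  "epi f = {(u, r). f u \<le> ereal r}"

lemma mem_epi [simp]: "(u, r) \<in> epi f \<longleftrightarrow> f u \<le> ereal r"
  by (simp add: epi_def)

lemma closed_epi:
  fixes f :: "'a::metric_space \<Rightarrow> ereal"
  assumes "lsc f"
  shows "closed (epi f)"
proof -
  have "\<exists>T. open T \<and> z \<in> T \<and> T \<subseteq> - epi f" if "z \<in> - epi f" for z
  proof -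
    obtain u r where z: "z = (u, r)" by (cases z)
    then obtain s where s: "r < s" "ereal s < f u"
      using \<open>z \<in> - epi f\<close> ereal_dense2[of "ereal r" "f u"]
      by (metis ComplD ereal_less_eq(3) linorder_not_le mem_epi)
    have "ereal s < Liminf (nhds u) f"
      using s assms by (auto simp: lsc_def intro: less_le_trans)
    then have "eventually (\<lambda>v. ereal s < f v) (nhds u)"
      by (rule less_LiminfD)
    then obtain S where S: "open S" "u \<in> S" "\<And>v. v \<in> S \<Longrightarrow> ereal s < f v"
      by (auto simp: eventually_nhds)
    \<comment> \<open>The level \<open>s\<close> leaves room on both sides: heights below
      \<open>s\<close> contain \<open>r\<close>, while values of \<open>f\<close> near
      \<open>u\<close> stay above \<open>s\<close>.\<close>
    have "S \<times> {..<s} \<subseteq> - epi f"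
    proof
      fix q assume "q \<in> S \<times> {..<s}"
      then obtain v t where q: "q = (v, t)" "v \<in> S" "t < s" by auto
      then have "ereal t < f v" using S(3)[of v] by (metis ereal_less(2) less_ereal.simps(1) order.strict_trans)
      then show "q \<in> - epi f" using q by auto
    qed
    then show ?thesis
      using S s z by (intro exI[of _ "S \<times> {..<s}"]) (auto intro: open_Times)
  qed
  then have "open (- epi f)"
    by (subst open_subopen) blast
  then show ?thesis
    by (simp add: closed_def)
qed

lemma convex_epi:
  assumes "econvex f"
  shows "convex (epi f)"
  unfolding convex_alt
proof clarify
  fix u v :: 'a and r s t :: real
  assume *: "(u, r) \<in> epi f" "(v, s) \<in> epi f" "0 \<le> t" "t \<le> 1"
  have "f ((1 - t) *\<^sub>R u + t *\<^sub>R v) \<le> ereal (1 - t) * f u + ereal t * f v"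
    using assms * by (auto simp: econvex_def)
  also have "\<dots> \<le> ereal (1 - t) * ereal r + ereal t * ereal s"
    using * by (intro add_mono ereal_mult_left_mono) auto
  finally show "(1 - t) *\<^sub>R (u, r) + t *\<^sub>R (v, s) \<in> epi f"
    by simp
qed

lemma epi_cmult:
  assumes "c > 0"
  shows "epi (\<lambda>z. ereal c * f z) = (\<lambda>(u, r). (u, r / c)) -` epi f"
proof -
  have "ereal c * f u \<le> ereal r \<longleftrightarrow> f u \<le> ereal (r / c)" for u r
    using assms by (cases "f u") (auto simp: field_simps)
  then show ?thesis by (auto simp: epi_def)
qed

lemma
  fixes f :: "'a::real_normed_vector \<Rightarrow> ereal"
  assumes "c > 0"
  shows closed_epi_cmult: "closed (epi f) \<Longrightarrow> closed (epi (\<lambda>z. ereal c * f z))"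
    and convex_epi_cmult: "convex (epi f) \<Longrightarrow> convex (epi (\<lambda>z. ereal c * f z))"
  unfolding epi_cmult[OF assms]
proof -
  show "closed ((\<lambda>(u, r). (u, r / c)) -` epi f)" if "closed (epi f)"
    using that assms by (intro closed_vimage) (auto simp: case_prod_unfold intro!: continuous_intros)
  show "convex ((\<lambda>(u, r). (u, r / c)) -` epi f)" if "convex (epi f)"
    using that by (intro convex_linear_vimage)
      (auto simp: linear_iff case_prod_unfold add_divide_distrib)
qed

text \<open>A supremum of affine functions has an intersection of half-spaces as its epigraph.
  Indexing by \<open>epi f\<close> keeps every offset real, so closedness and convexity can be
  checked one half-space at a time.\<close>

lemma epi_conjugate:
  assumes "proper f"
  shows "epi (conjugate f) = (\<Inter>(x, t)\<in>epi f. {(y, r). y \<bullet> x - r \<le> t})"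
proof -
  have "conjugate f y \<le> ereal r \<longleftrightarrow> (\<forall>x t. f x \<le> ereal t \<longrightarrow> y \<bullet> x - r \<le> t)" for y r
  proof -
    have "ereal (y \<bullet> x) - f x \<le> ereal r \<longleftrightarrow> (\<forall>t. f x \<le> ereal t \<longrightarrow> y \<bullet> x - r \<le> t)" for x
      using assms by (cases "f x") (auto simp: proper_def algebra_simps)
    then show ?thesis by (simp add: conjugate_def SUP_le_iff)
  qed
  then show ?thesis by (auto simp: epi_def)
qed

lemma closed_epi_conjugate: "proper f \<Longrightarrow> closed (epi (conjugate f))"
  unfolding epi_conjugate
  by (auto simp: case_prod_unfold intro!: closed_INT closed_Collect_le continuous_intros)

lemma convex_epi_conjugate:
  assumes "proper f"
  shows "convex (epi (conjugate f))"
proof -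
  have "convex {(y, r). y \<bullet> x - r \<le> t}" for x :: 'a and t
  proof -
    have "{(y, r). y \<bullet> x - r \<le> t} = (\<lambda>(y, r). y \<bullet> x - r) -` {..t}" by auto
    also have "convex \<dots>"
      by (intro convex_linear_vimage)
        (auto simp: linear_iff case_prod_unfold inner_add_left algebra_simps)
    finally show ?thesis .
  qed
  then show ?thesis
    unfolding epi_conjugate[OF assms] by (auto intro!: convex_INT)
qed

text \<open>A point one unit below the graph is strictly separated from the closed convex epigraph.
  The hyperplane cannot be vertical, since it also separates that point from the graph point above
  it; solving for the height yields the minorant.\<close>

lemma affine_minorant:
  fixes f :: "'a::euclidean_space \<Rightarrow> ereal"
  assumes "closed (epi f)" "convex (epi f)" "proper f"
  obtains b c where "\<And>u. ereal (b \<bullet> u + c) \<le> f u"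
proof -
  obtain x0 r0 where x0: "f x0 = ereal r0"
    using assms(3) unfolding proper_def by (metis ereal_cases)
  have "(x0, r0 - 1) \<notin> epi f" using x0 by simp
  from separating_hyperplane_closed_point[OF assms(2,1) this]
  obtain a e where a: "a \<bullet> (x0, r0 - 1) < e" "\<And>z. z \<in> epi f \<Longrightarrow> e < a \<bullet> z"
    by blast
  obtain d s where ds: "a = (d, s)" by (cases a)
  have "e < d \<bullet> x0 + s * r0" using a(2)[of "(x0, r0)"] x0 ds by simp
  moreover have "d \<bullet> x0 + s * (r0 - 1) < e" using a(1) ds by simp
  ultimately have s: "s > 0" by (simp add: algebra_simps)
  have "ereal ((- (1 / s) *\<^sub>R d) \<bullet> u + e / s) \<le> f u" for u
  proof (cases "f u")
    case (real r)
    then have "e < d \<bullet> u + s * r" using a(2)[of "(u, r)"] ds by simp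
    then show ?thesis using real s by (simp add: field_simps)
  qed (use assms(3) in \<open>auto simp: proper_def\<close>)
  then show thesis by (rule that)
qed

text \<open>The slope of an affine minorant of \<open>f\<close> is a point where the conjugate is
  bounded above. A point where \<open>f\<close> is finite bounds the conjugate below
  everywhere.\<close>

lemma proper_conjugate:
  fixes f :: "'a::euclidean_space \<Rightarrow> ereal"
  assumes "proper f" "econvex f" "lsc f"
  shows "proper (conjugate f)"
proof -
  obtain b c where bc: "\<And>u. ereal (b \<bullet> u + c) \<le> f u"
    using affine_minorant closed_epi convex_epi assms by metis
  have "ereal (b \<bullet> u) - f u \<le> ereal (- c)" for u
    using bc[of u] by (cases "f u") auto
  then have "conjugate f b \<le> ereal (- c)"
    by (simp add: conjugate_def SUP_le_iff)
  moreover obtain x0 r0 where x0: "f x0 = ereal r0"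
    using assms(1) unfolding proper_def by (metis ereal_cases)
  have "ereal (y \<bullet> x0 - r0) \<le> conjugate f y" for y
    unfolding conjugate_def by (rule SUP_upper2[of x0]) (simp_all add: x0)
  then have "conjugate f y \<noteq> -\<infinity>" for y
    by (metis MInfty_neq_ereal(1) ereal_infty_less_eq(2))
  ultimately show ?thesis
    unfolding proper_def by (metis PInfty_neq_ereal(1) ereal_infty_less_eq(1))
qed

lemma proper_cmult: "proper f \<Longrightarrow> c > 0 \<Longrightarrow> proper (\<lambda>z. ereal c * f z)"
  by (auto simp: proper_def)

text \<open>An infinite value at \<open>x\<close> would make the subgradient inequality force
  \<open>f\<close> to be infinite everywhere. This is what licenses the passage to
  \<open>real_of_ereal\<close> later.\<close>

lemma subdifferential_finite:
  assumes "proper f" "u \<in> subdifferential f x"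
  shows "\<bar>f x\<bar> \<noteq> \<infinity>"
proof -
  obtain z where "f z \<noteq> \<infinity>" using assms(1) by (auto simp: proper_def)
  then show ?thesis using assms by (auto simp: proper_def subdifferential_def)
qed

lemma subgradient_le:
  assumes "u \<in> subdifferential f x" "\<bar>f x\<bar> \<noteq> \<infinity>" "\<bar>f z\<bar> \<noteq> \<infinity>"
  shows "real_of_ereal (f x) + u \<bullet> (z - x) \<le> real_of_ereal (f z)"
proof -
  have "f x + ereal (u \<bullet> (z - x)) \<le> f z" using assms(1) by (simp add: subdifferential_def)
  then show ?thesis using assms(2,3) by (cases "f x"; cases "f z") auto
qed

lemma subdifferential_cmult:
  assumes "c > 0" "u \<in> subdifferential (\<lambda>z. ereal c * f z) x"
  shows "(1 / c) *\<^sub>R u \<in> subdifferential f x"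
proof -
  have "f x + ereal ((1 / c) *\<^sub>R u \<bullet> (z - x)) \<le> f z" for z
  proof -
    have "ereal c * f x + ereal (u \<bullet> (z - x)) \<le> ereal c * f z"
      using assms(2) by (auto simp: subdifferential_def)
    then show ?thesis
      using assms(1) by (cases "f x"; cases "f z") (auto simp: field_simps)
  qed
  then show ?thesis by (simp add: subdifferential_def)
qed

lemma subdifferential_monotone:
  assumes "proper f" "u \<in> subdifferential f x" "v \<in> subdifferential f y"
  shows "0 \<le> (u - v) \<bullet> (x - y)"
proof -
  have "\<bar>f x\<bar> \<noteq> \<infinity>" "\<bar>f y\<bar> \<noteq> \<infinity>"
    using subdifferential_finite[OF assms(1)] assms(2,3) by auto
  moreover have "f x + ereal (u \<bullet> (y - x)) \<le> f y" "f y + ereal (v \<bullet> (x - y)) \<le> f x"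
    using assms(2,3) by (auto simp: subdifferential_def)
  ultimately show ?thesis
    by (cases "f x"; cases "f y") (auto simp: inner_diff_left inner_diff_right)
qed

section \<open>The proximal operator\<close>

text \<open>The operator \<open>prox\<close> is a choice, so a minimizer has to be exhibited. The
  sublevel sets \<open>K d\<close> of the objective are closed, and bounded because the quadratic
  term beats an affine minorant of \<open>f\<close>; by compactness, those at levels decreasing to
  the infimum have a common point.\<close>

lemma prox_minimizes:
  fixes f :: "'a::euclidean_space \<Rightarrow> ereal"
  assumes "closed (epi f)" "convex (epi f)" "proper f"
  shows "f (prox f z) + ereal (1 / 2 * (norm (z - prox f z))\<^sup>2) \<le> f v + ereal (1 / 2 * (norm (z - v))\<^sup>2)"
proof -
  define q where "q u = 1 / 2 * (norm (z - u))\<^sup>2" for u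
  define K where "K d = {u. f u + ereal (q u) \<le> ereal d}" for d
  obtain b c where bc: "\<And>u. ereal (b \<bullet> u + c) \<le> f u"
    using affine_minorant[OF assms] by metis
  have lower: "b \<bullet> z + c - norm b * norm (z - u) + q u \<le> d" if "u \<in> K d" for u d
  proof -
    have "ereal (b \<bullet> u + c) + ereal (q u) \<le> ereal d"
      using that bc[of u] by (cases "f u") (auto simp: K_def)
    moreover have "b \<bullet> (z - u) \<le> norm b * norm (z - u)" by (rule norm_cauchy_schwarz)
    ultimately show ?thesis by (simp add: inner_diff_right)
  qed
  have closedK: "closed (K d)" for d
  proof -
    have "f u + ereal (q u) \<le> ereal d \<longleftrightarrow> f u \<le> ereal (d - q u)" for u
      by (cases "f u") auto
    then have "K d = (\<lambda>u. (u, d - q u)) -` epi f"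
      by (simp only: K_def vimage_def mem_epi)
    also have "closed \<dots>"
      unfolding q_def using assms(1) by (intro closed_vimage) (auto intro!: continuous_intros)
    finally show ?thesis .
  qed
  have boundedK: "bounded (K d)" for d
  proof -
    define e where "e = \<bar>d - c - b \<bullet> z\<bar>"
    \<comment> \<open>Beyond this radius both the distance and the distance minus
      \<open>2 * norm b\<close> exceed \<open>1 + e\<close>, so their product is at least
      \<open>(1 + e) * (1 + e)\<close>. The lower bound on the objective caps the product at
      \<open>2 * e\<close>, a contradiction.\<close>
    have "norm (z - u) \<le> 2 * norm b + e + 1" if "u \<in> K d" for u
    proof (rule ccontr)
      let ?s = "norm (z - u)" and ?B = "norm b"
      assume "\<not> ?thesis"
      then have s: "2 * ?B + e + 1 < ?s" by simp
      have "e \<ge> 0" by (simp add: e_def)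
      have "(1 + e) * (1 + e) \<le> ?s * (?s - 2 * ?B)"
        using s \<open>e \<ge> 0\<close> norm_ge_zero[of b] by (intro mult_mono) linarith+
      moreover have "?s * (?s - 2 * ?B) \<le> 2 * e"
      proof -
        have "b \<bullet> z + c - ?B * ?s + ?s * ?s / 2 \<le> d"
          using lower[OF that] by (simp add: q_def power2_eq_square)
        moreover have "?s * (?s - 2 * ?B) = ?s * ?s - 2 * (?B * ?s)"
          by (simp add: algebra_simps)
        moreover have "d - c - b \<bullet> z \<le> e" by (simp add: e_def)
        ultimately show ?thesis by linarith
      qed
      ultimately have "1 + e * e \<le> 0" by (simp add: algebra_simps)
      then show False using zero_le_square[of e] by linarith
    qed
    then have "K d \<subseteq> cball z (2 * norm b + e + 1)" by (auto simp: dist_norm)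
    then show ?thesis using bounded_cball bounded_subset by blast
  qed
  have monoK: "K d \<subseteq> K d'" if "d \<le> d'" for d d'
    using that by (auto simp: K_def intro: order_trans)
  define m where "m = Inf {d. K d \<noteq> {}}"
  have ne: "{d. K d \<noteq> {}} \<noteq> {}"
  proof -
    obtain x0 r0 where "f x0 = ereal r0"
      using assms(3) unfolding proper_def by (metis ereal_cases)
    then have "x0 \<in> K (r0 + q x0)" by (simp add: K_def)
    then show ?thesis by blast
  qed
  have bdd: "bdd_below {d. K d \<noteq> {}}"
  proof (rule bdd_belowI)
    fix d assume "d \<in> {d. K d \<noteq> {}}"
    then obtain u where "u \<in> K d" by auto
    \<comment> \<open>Completing the square in the distance from \<open>z\<close> to
      \<open>u\<close> removes the dependence on \<open>u\<close>.\<close>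
    from lower[OF this] zero_le_power2[of "norm b - norm (z - u)"]
    show "b \<bullet> z + c - (norm b)\<^sup>2 / 2 \<le> d"
      by (simp add: q_def power2_eq_square algebra_simps)
  qed
  have "\<Inter> (range (\<lambda>n::nat. K (m + 1 / real (Suc n)))) \<noteq> {}"
  proof (rule compact_nest)
    show "compact (K (m + 1 / real (Suc n)))" for n
      using closedK boundedK by (simp add: compact_eq_bounded_closed)
    show "K (m + 1 / real (Suc n)) \<noteq> {}" for n
    proof -
      have "Inf {d. K d \<noteq> {}} < m + 1 / real (Suc n)" by (simp add: m_def)
      from cInf_lessD[OF ne this] obtain d where "K d \<noteq> {}" "d < m + 1 / real (Suc n)" by auto
      then show ?thesis using monoK[of d] by (metis less_imp_le subset_empty)
    qed
    show "K (m + 1 / real (Suc n)) \<subseteq> K (m + 1 / real (Suc k))" if "k \<le> n" for k n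
      using that by (intro monoK) (simp add: frac_le)
  qed
  then obtain u where u: "\<And>n. u \<in> K (m + 1 / real (Suc n))" by blast
  \<comment> \<open>A point in all these sets has objective value at most
    \<open>m + 1 / real (Suc n)\<close> for every \<open>n\<close>, hence at most the infimum
    \<open>m\<close>.\<close>
  have le: "f u + ereal (q u) \<le> f v + ereal (q v)" for v
  proof (cases "f v")
    case (real r)
    then have "v \<in> K (r + q v)" by (simp add: K_def)
    then have "m \<le> r + q v" unfolding m_def using bdd by (intro cInf_lower) auto
    moreover obtain s where s: "f u = ereal s"
      using u[of 0] assms(3) by (cases "f u") (auto simp: K_def proper_def)
    have "s + q u \<le> m"
    proof (rule field_le_epsilon)
      fix e :: real assume "e > 0"
      then obtain n where "1 / real (Suc n) < e" using nat_approx_posE by metis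
      then show "s + q u \<le> m + e" using u[of n] s by (simp add: K_def)
    qed
    ultimately show ?thesis using real s by simp
  qed (use assms(3) in \<open>auto simp: proper_def\<close>)
  have "is_arg_min (\<lambda>v. f v + ereal (q v)) (\<lambda>_. True) u"
    using le by (auto simp: is_arg_min_def not_less)
  then have "is_arg_min (\<lambda>v. f v + ereal (q v)) (\<lambda>_. True) (prox f z)"
    unfolding prox_def q_def arg_min_def by (rule someI)
  then show ?thesis
    unfolding is_arg_min_def q_def by (meson leI)
qed

text \<open>The minimizer \<open>u\<close> is compared with the point at parameter \<open>t\<close>
  on the segment from \<open>u\<close> to \<open>v\<close>. Convexity bounds \<open>f\<close> there;
  after division by \<open>t\<close> the quadratic remainder vanishes as \<open>t\<close> tends to 0
  from the right.\<close>

lemma prox_subdifferential: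
  fixes f :: "'a::euclidean_space \<Rightarrow> ereal"
  assumes "closed (epi f)" "convex (epi f)" "proper f"
  shows "z - prox f z \<in> subdifferential f (prox f z)"
proof -
  define u where "u = prox f z"
  note min = prox_minimizes[OF assms, of z, folded u_def]
  obtain a where a: "f u = ereal a"
  proof -
    obtain x0 r0 where "f x0 = ereal r0"
      using assms(3) unfolding proper_def by (metis ereal_cases)
    then show thesis using that min[of x0] assms(3) by (cases "f u") (auto simp: proper_def)
  qed
  have "f u + ereal ((z - u) \<bullet> (v - u)) \<le> f v" for v
  proof (cases "f v")
    case (real b)
    have *: "(z - u) \<bullet> (v - u) \<le> b - a + t * (1 / 2 * (norm (v - u))\<^sup>2)" if t: "0 < t" "t < 1" for t
    proof -
      have "(1 - t) *\<^sub>R (u, a) + t *\<^sub>R (v, b) \<in> epi f"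
        using assms(2) a real t by (intro convexD_alt) auto
      then have "f ((1 - t) *\<^sub>R u + t *\<^sub>R v) \<le> ereal ((1 - t) * a + t * b)"
        by simp
      with min[of "(1 - t) *\<^sub>R u + t *\<^sub>R v"] a
      have "a + 1 / 2 * (norm (z - u))\<^sup>2 \<le> (1 - t) * a + t * b + 1 / 2 * (norm (z - ((1 - t) *\<^sub>R u + t *\<^sub>R v)))\<^sup>2"
        by (cases "f ((1 - t) *\<^sub>R u + t *\<^sub>R v)") auto
      moreover have "z - ((1 - t) *\<^sub>R u + t *\<^sub>R v) = (z - u) - t *\<^sub>R (v - u)"
        by (simp add: algebra_simps)
      then have "(norm (z - ((1 - t) *\<^sub>R u + t *\<^sub>R v)))\<^sup>2
          = (norm (z - u))\<^sup>2 - 2 * t * ((z - u) \<bullet> (v - u)) + t * t * (norm (v - u))\<^sup>2"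
        unfolding power2_norm_eq_inner
        by (simp add: inner_diff_left inner_diff_right inner_commute algebra_simps)
      ultimately have "t * ((z - u) \<bullet> (v - u)) \<le> t * (b - a + t * (1 / 2 * (norm (v - u))\<^sup>2))"
        by (simp add: algebra_simps)
      then show ?thesis using t by simp
    qed
    have "((\<lambda>t. b - a + t * (1 / 2 * (norm (v - u))\<^sup>2)) \<longlongrightarrow> b - a + 0 * (1 / 2 * (norm (v - u))\<^sup>2)) (at_right 0)"
      by (intro tendsto_intros)
    moreover have "eventually (\<lambda>t. (z - u) \<bullet> (v - u) \<le> b - a + t * (1 / 2 * (norm (v - u))\<^sup>2)) (at_right 0)"
      using * by (auto simp: eventually_at_right_field intro!: exI[of _ 1])
    ultimately have "(z - u) \<bullet> (v - u) \<le> b - a + 0 * (1 / 2 * (norm (v - u))\<^sup>2)"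
      by (intro tendsto_lowerbound) auto
    then show ?thesis using a real by simp
  qed (use assms(3) in \<open>auto simp: proper_def\<close>)
  then show ?thesis by (simp add: subdifferential_def u_def)
qed

text \<open>Monotonicity of the subdifferential, applied to the two residuals, gives firm
  nonexpansiveness, and Cauchy-Schwarz does the rest. The resulting continuity makes the iterates
  measurable.\<close>

lemma prox_nonexpansive:
  fixes f :: "'a::euclidean_space \<Rightarrow> ereal"
  assumes "closed (epi f)" "convex (epi f)" "proper f"
  shows "norm (prox f z - prox f z') \<le> norm (z - z')"
proof -
  define d where "d = prox f z - prox f z'"
  have "0 \<le> ((z - prox f z) - (z' - prox f z')) \<bullet> d"
    unfolding d_def
    by (intro subdifferential_monotone[OF assms(3)] prox_subdifferential assms)
  then have "d \<bullet> d \<le> (z - z') \<bullet> d"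
    by (simp add: d_def inner_diff_left inner_diff_right inner_commute)
  also have "\<dots> \<le> norm (z - z') * norm d" by (rule norm_cauchy_schwarz)
  finally have "norm d * norm d \<le> norm (z - z') * norm d"
    by (simp add: norm_eq_square flip: power2_norm_eq_inner power2_eq_square)
  then show ?thesis
    unfolding d_def[symmetric] by (cases "d = 0") auto
qed

lemma prox_measurable [measurable]:
  fixes f :: "'a::euclidean_space \<Rightarrow> ereal"
  assumes "closed (epi f)" "convex (epi f)" "proper f"
  shows "prox f \<in> borel_measurable borel"
proof (rule borel_measurable_continuous_onI)
  have "1-lipschitz_on UNIV (prox f)"
    using prox_nonexpansive[OF assms] by (auto simp: lipschitz_on_def dist_norm)
  then show "continuous_on UNIV (prox f)" by (rule lipschitz_on_continuous_on)
qed

lemma closed_epi_measurable: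
  fixes f :: "'a::euclidean_space \<Rightarrow> ereal"
  assumes "closed (epi f)"
  shows "f \<in> borel_measurable borel"
proof (rule borel_measurableI_le)
  fix r :: ereal
  have real: "closed {u. f u \<le> ereal s}" for s
  proof -
    have "{u. f u \<le> ereal s} = (\<lambda>u. (u, s)) -` epi f" by auto
    then show ?thesis using assms by (auto intro!: closed_vimage continuous_intros)
  qed
  show "{u \<in> space borel. f u \<le> r} \<in> sets borel"
  proof (cases r)
    case MInf
    \<comment> \<open>Sublevel sets at real heights are closed slices of the epigraph; the one at
      minus infinity is their intersection over the heights \<open>- real n\<close>.\<close>
    have "f u = -\<infinity>" if "\<forall>n. f u \<le> ereal (- real n)" for u
    proof (cases "f u")
      case (real t)
      obtain n where "- t < real n" using reals_Archimedean2 by blast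
      moreover have "t \<le> - real n" using that real by auto
      ultimately show ?thesis by linarith
    qed (use that in auto)
    then have "{u. f u \<le> r} = (\<Inter>n::nat. {u. f u \<le> ereal (- real n)})"
      using MInf by auto
    then show ?thesis using real by (auto intro!: borel_closed closed_INT)
  qed (use real in auto)
qed

section \<open>Smooth convex functions\<close>

text \<open>The derivative is represented by the vector \<open>adjoint F' 1\<close>. Uniqueness of
  derivatives then makes the definite description in \<open>grad\<close> meaningful.\<close>

lemma GDERIV_grad:
  fixes F :: "'a::euclidean_space \<Rightarrow> real"
  assumes "F differentiable (at x)"
  shows "GDERIV F x :> grad F x"
proof -
  obtain F' where F': "(F has_derivative F') (at x)"
    using assms by (auto simp: differentiable_def)
  have eq: "F' = (\<lambda>h. h \<bullet> adjoint F' 1)"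
    using adjoint_works[of F' _ 1] has_derivative_linear[OF F'] by (intro ext) simp
  then have "GDERIV F x :> adjoint F' 1"
    unfolding gderiv_def by (subst eq[symmetric]) (rule F')
  moreover have "D = adjoint F' 1" if "GDERIV F x :> D" for D
  proof -
    have "(\<lambda>h. h \<bullet> D) = (\<lambda>h. h \<bullet> adjoint F' 1)"
      using that calculation unfolding gderiv_def by (rule has_derivative_unique)
    then show ?thesis by (metis inner_commute vector_eq_rdot)
  qed
  ultimately show ?thesis
    unfolding grad_def by (rule theI)
qed

text \<open>Restricting \<open>F\<close> to the line through \<open>x\<close> and \<open>y\<close>
  reduces the claim to the tangent inequality for convex functions of one real variable.\<close>

lemma convex_on_grad_le:
  fixes F :: "'a::euclidean_space \<Rightarrow> real"
  assumes "convex_on UNIV F" "F differentiable (at x)"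
  shows "grad F x \<bullet> (y - x) \<le> F y - F x"
proof -
  define \<phi> where "\<phi> t = F (x + t *\<^sub>R (y - x))" for t
  have "convex_on UNIV \<phi>"
  proof (rule convex_onI)
    fix t s r :: real assume "0 < t" "t < 1"
    then show "\<phi> ((1 - t) *\<^sub>R s + t *\<^sub>R r) \<le> (1 - t) * \<phi> s + t * \<phi> r"
      using convex_onD[OF assms(1), of t "x + s *\<^sub>R (y - x)" "x + r *\<^sub>R (y - x)"]
      by (simp add: \<phi>_def algebra_simps)
  qed simp
  moreover have "(\<phi> has_real_derivative (y - x) \<bullet> grad F x) (at 0)"
  proof -
    have "(F has_derivative (\<lambda>h. h \<bullet> grad F x)) (at (x + 0 *\<^sub>R (y - x)))"
      using GDERIV_grad[OF assms(2)] by (simp add: gderiv_def)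
    then have "(F \<circ> (\<lambda>t. x + t *\<^sub>R (y - x)) has_derivative (\<lambda>h. h \<bullet> grad F x) \<circ> (\<lambda>t. t *\<^sub>R (y - x))) (at 0)"
      by (intro diff_chain_at) (auto intro!: derivative_eq_intros)
    then show ?thesis
      by (simp add: has_field_derivative_def \<phi>_def[abs_def] o_def mult.commute[of _ "_ \<bullet> _"])
  qed
  ultimately have "\<phi> 1 - \<phi> 0 \<ge> ((y - x) \<bullet> grad F x) * (1 - 0)"
    by (intro convex_on_imp_above_tangent[where A = UNIV and c = 0]) auto
  then show ?thesis by (simp add: \<phi>_def inner_commute)
qed

text \<open>The tangent inequality at \<open>x'\<close> gives the sign. The one at \<open>x\<close>
  bounds the divergence by the inner product of the gradient difference with \<open>x - x'\<close>.
  The constant lacks the usual factor 1/2, which is harmless as the upper bound serves integrability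
  only.\<close>

lemma bregman_bounds:
  fixes F :: "'a::euclidean_space \<Rightarrow> real"
  assumes "convex_on UNIV F" "smooth_with \<nu> F"
  shows "0 \<le> bregman F x x'" "bregman F x x' \<le> \<nu> * (norm (x - x'))\<^sup>2"
proof -
  have d: "F differentiable (at z)" for z using assms(2) by (simp add: smooth_with_def)
  show "0 \<le> bregman F x x'"
    using convex_on_grad_le[OF assms(1) d, of x' x] by (simp add: bregman_def)
  have "norm (grad F x - grad F x') \<le> \<nu> * norm (x - x')"
    using assms(2) by (auto simp: smooth_with_def lipschitz_on_def dist_norm)
  have "bregman F x x' \<le> (grad F x - grad F x') \<bullet> (x - x')"
    using convex_on_grad_le[OF assms(1) d, of x x'] by (simp add: bregman_def inner_diff_left inner_diff_right)
  also have "\<dots> \<le> norm (grad F x - grad F x') * norm (x - x')" by (rule norm_cauchy_schwarz)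
  also have "\<dots> \<le> \<nu> * norm (x - x') * norm (x - x')"
    by (intro mult_right_mono) (fact, simp)
  finally show "bregman F x x' \<le> \<nu> * (norm (x - x'))\<^sup>2"
    by (simp add: power2_eq_square)
qed

section \<open>The energy inequality of one step\<close>

text \<open>The adjoint has norm at most \<open>onorm L\<close>, so the step size condition makes
  the subtracted term of the \<open>P\<close>-norm at most its dual term.\<close>

lemma normP_sq_bound:
  fixes L :: "'a::euclidean_space \<Rightarrow> 'b::euclidean_space"
  assumes "linear L" "\<gamma> > 0" "\<tau> > 0" "\<gamma> * \<tau> * (onorm L)\<^sup>2 < 1"
  shows "(norm (fst v))\<^sup>2 \<le> normP_sq \<gamma> \<tau> L v"
proof -
  define u where "u = snd v"
  have "norm (adjoint L u) * norm (adjoint L u) = L (adjoint L u) \<bullet> u"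
    using adjoint_works[OF assms(1), of "adjoint L u" u]
    by (simp flip: power2_norm_eq_inner power2_eq_square)
  also have "\<dots> \<le> norm (L (adjoint L u)) * norm u" by (rule norm_cauchy_schwarz)
  also have "\<dots> \<le> onorm L * norm (adjoint L u) * norm u"
    using assms(1) by (intro mult_right_mono onorm) (auto simp: linear_conv_bounded_linear)
  finally have "norm (adjoint L u) * norm (adjoint L u) \<le> (onorm L * norm u) * norm (adjoint L u)"
    by (simp add: ac_simps)
  then have "norm (adjoint L u) \<le> onorm L * norm u"
    using onorm_pos_le[of L] assms(1)
    by (cases "adjoint L u = 0") (auto simp: linear_conv_bounded_linear)
  then have "(norm (adjoint L u))\<^sup>2 \<le> (onorm L)\<^sup>2 * (norm u)\<^sup>2"
    by (metis norm_ge_zero power_mono power_mult_distrib)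
  then have "\<gamma>\<^sup>2 * (norm (adjoint L u))\<^sup>2 \<le> \<gamma>\<^sup>2 * ((onorm L)\<^sup>2 * (norm u)\<^sup>2)"
    by (intro mult_left_mono) auto
  also have "\<dots> = (\<gamma> * \<tau> * (onorm L)\<^sup>2) * (\<gamma> / \<tau> * (norm u)\<^sup>2)"
    using assms by (simp add: field_simps power2_eq_square)
  also have "\<dots> \<le> 1 * (\<gamma> / \<tau> * (norm u)\<^sup>2)"
    using assms by (intro mult_right_mono) auto
  finally show ?thesis by (simp add: normP_sq_def u_def)
qed

text \<open>In one step, \<open>X = x - x\<^sup>\<star>\<close>, \<open>G = g - \<nabla>F x\<^sup>\<star>\<close>, \<open>r\<close> is the difference of the subgradients of \<open>R\<close>, \<open>u\<close> and \<open>u'\<close>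
  are the old and new dual errors, \<open>A\<close> and \<open>B\<close> their images under the adjoint of \<open>L\<close>; the factor after \<open>2 * \<gamma>\<close>
  bounds the Lagrangian gap up to the gradient noise.\<close>

lemma energy_identity:
  fixes X r G A B :: "'a::real_inner" and u u' :: "'b::real_inner" and \<gamma> \<tau> :: real
  shows "(norm (X + \<gamma> *\<^sub>R r))\<^sup>2 + \<gamma> / \<tau> * (norm u)\<^sup>2 - \<gamma>\<^sup>2 * (norm A)\<^sup>2
    - ((norm (X - \<gamma> *\<^sub>R G - \<gamma> *\<^sub>R B))\<^sup>2 + \<gamma> / \<tau> * (norm u')\<^sup>2 - \<gamma>\<^sup>2 * (norm B)\<^sup>2)
    = 2 * \<gamma> * ((G + r) \<bullet> X + 1 / \<tau> * ((u - u') \<bullet> u') + (X - \<gamma> *\<^sub>R r - \<gamma> *\<^sub>R G - \<gamma> *\<^sub>R A) \<bullet> B)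
      + \<gamma>\<^sup>2 * (norm (r + B))\<^sup>2 + (\<gamma> / \<tau> * (norm (u' - u))\<^sup>2 - \<gamma>\<^sup>2 * (norm (B - A))\<^sup>2)
      - \<gamma>\<^sup>2 * (norm G)\<^sup>2"
proof -
  \<comment> \<open>The dual part is polarized separately; what remains is an expansion of squares
    in the primal space.\<close>
  have "(norm u)\<^sup>2 - (norm u')\<^sup>2 = 2 * ((u - u') \<bullet> u') + (norm (u' - u))\<^sup>2"
    unfolding power2_norm_eq_inner by (simp add: inner_diff_left inner_diff_right inner_commute)
  then have "\<gamma> / \<tau> * ((norm u)\<^sup>2 - (norm u')\<^sup>2)
      = \<gamma> / \<tau> * (2 * ((u - u') \<bullet> u') + (norm (u' - u))\<^sup>2)"
    by simp
  moreover have "(norm (X + \<gamma> *\<^sub>R r))\<^sup>2 - \<gamma>\<^sup>2 * (norm A)\<^sup>2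
      - ((norm (X - \<gamma> *\<^sub>R G - \<gamma> *\<^sub>R B))\<^sup>2 - \<gamma>\<^sup>2 * (norm B)\<^sup>2)
    = 2 * \<gamma> * ((G + r) \<bullet> X + (X - \<gamma> *\<^sub>R r - \<gamma> *\<^sub>R G - \<gamma> *\<^sub>R A) \<bullet> B)
      + \<gamma>\<^sup>2 * (norm (r + B))\<^sup>2 - \<gamma>\<^sup>2 * (norm (B - A))\<^sup>2 - \<gamma>\<^sup>2 * (norm G)\<^sup>2"
    unfolding power2_norm_eq_inner
    by (simp add: inner_diff_left inner_diff_right inner_add_left inner_add_right inner_commute
        power2_eq_square algebra_simps)
  ultimately show ?thesis by (simp add: algebra_simps)
qed

text \<open>The deterministic setting. One step is analysed here with an arbitrary vector
  \<open>g\<close> in the role of the gradient estimate, so the result later applies to every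
  outcome separately.\<close>

locale pd3o =
  fixes F :: "'a::euclidean_space \<Rightarrow> real"
    and R :: "'a \<Rightarrow> ereal"
    and H :: "'b::euclidean_space \<Rightarrow> ereal"
    and L :: "'a \<Rightarrow> 'b"
    and xstar :: 'a and ystar :: 'b and \<nu> \<gamma> \<tau> :: real
  assumes linear_L: "linear L"
    and convex_F: "convex_on UNIV F" and smooth_F: "smooth_with \<nu> F"
    and R: "proper R" "econvex R" "lsc R"
    and H: "proper H" "econvex H" "lsc H"
    and solution: "primal_dual_solution F R H L xstar ystar"
    and \<gamma>_pos: "\<gamma> > 0" and \<tau>_pos: "\<tau> > 0"
    and step_size: "\<gamma> * \<tau> * (onorm L)\<^sup>2 < 1"
begin

abbreviation Hc :: "'b \<Rightarrow> ereal" where "Hc \<equiv> conjugate H"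
abbreviation Rr :: "'a \<Rightarrow> real" where "Rr x \<equiv> real_of_ereal (R x)"
abbreviation Hr :: "'b \<Rightarrow> real" where "Hr y \<equiv> real_of_ereal (Hc y)"

definition pstar :: 'a where
  "pstar = xstar - \<gamma> *\<^sub>R grad F xstar - \<gamma> *\<^sub>R adjoint L ystar"

definition energy :: "'a \<Rightarrow> 'b \<Rightarrow> real" where
  "energy p y = normP_sq \<gamma> \<tau> L ((p, y) - (pstar, ystar))"

text \<open>The Lagrangian gap between \<open>(x, y\<^sup>\<star>)\<close> and \<open>(x\<^sup>\<star>, y)\<close>, but only where \<open>R x\<close> and \<open>Hc y\<close> are finite:
  \<^const>\<open>real_of_ereal\<close> sends infinite values to \<open>0\<close>.\<close>

definition step_gap :: "'a \<Rightarrow> 'b \<Rightarrow> real" where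
  "step_gap x y = F x - F xstar + (Rr x - Rr xstar) + (Hr y - Hr ystar) + L x \<bullet> ystar - L xstar \<bullet> y"

lemma epi_R: "closed (epi R)" "convex (epi R)"
  using R closed_epi convex_epi by auto

lemma Hc: "closed (epi Hc)" "convex (epi Hc)" "proper Hc"
  using H closed_epi_conjugate convex_epi_conjugate proper_conjugate by auto

lemma adjoint_L: "L x \<bullet> y = x \<bullet> adjoint L y"
  using adjoint_works[OF linear_L] by metis

lemma L_subdifferential: "L xstar \<in> subdifferential Hc ystar"
  and R_subdifferential: "- grad F xstar - adjoint L ystar \<in> subdifferential R xstar"
proof -
  show "L xstar \<in> subdifferential Hc ystar"
    using solution by (simp add: primal_dual_solution_def)
  obtain r where "r \<in> subdifferential R xstar" "0 = grad F xstar + r + adjoint L ystar"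
    using solution by (auto simp: primal_dual_solution_def)
  moreover from this have "r = - grad F xstar - adjoint L ystar"
    by (simp add: algebra_simps eq_neg_iff_add_eq_0)
  ultimately show "- grad F xstar - adjoint L ystar \<in> subdifferential R xstar" by simp
qed

lemma R_finite: "u \<in> subdifferential R x \<Longrightarrow> \<bar>R x\<bar> \<noteq> \<infinity>"
  and Hc_finite: "v \<in> subdifferential Hc y \<Longrightarrow> \<bar>Hc y\<bar> \<noteq> \<infinity>"
  using subdifferential_finite[OF R(1)] subdifferential_finite[OF Hc(3)] by auto

lemma prox_R:
  assumes "x = prox (\<lambda>z. ereal \<gamma> * R z) p"
  shows "(1 / \<gamma>) *\<^sub>R (p - x) \<in> subdifferential R x"
  unfolding assms using \<gamma>_pos epi_R R(1)
  by (intro subdifferential_cmult prox_subdifferential closed_epi_cmult convex_epi_cmult proper_cmult)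

lemma prox_Hc:
  assumes "y = prox (\<lambda>z. ereal \<tau> * Hc z) q"
  shows "(1 / \<tau>) *\<^sub>R (q - y) \<in> subdifferential Hc y"
  unfolding assms using \<tau>_pos Hc
  by (intro subdifferential_cmult prox_subdifferential closed_epi_cmult convex_epi_cmult proper_cmult)

text \<open>The optimality conditions supply subgradients of \<open>R\<close> and \<open>Hc\<close>
  at the solution. Their inequalities cancel the bilinear terms and leave the linearization error of
  \<open>F\<close>. So the gap is nonnegative and can absorb the Bregman terms of the gradient
  assumption.\<close>

lemma bregman_le_step_gap:
  assumes "\<bar>R x\<bar> \<noteq> \<infinity>" "\<bar>Hc y\<bar> \<noteq> \<infinity>"
  shows "bregman F x xstar \<le> step_gap x y"
proof -
  have "Rr xstar + (- grad F xstar - adjoint L ystar) \<bullet> (x - xstar) \<le> Rr x"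
    using R_subdifferential R_finite assms by (intro subgradient_le) auto
  moreover have "Hr ystar + L xstar \<bullet> (y - ystar) \<le> Hr y"
    using L_subdifferential Hc_finite assms by (intro subgradient_le) auto
  moreover have "adjoint L ystar \<bullet> (x - xstar) = L x \<bullet> ystar - L xstar \<bullet> ystar"
    by (simp add: adjoint_L inner_diff_right inner_commute[of "adjoint L ystar"])
  ultimately show ?thesis
    by (simp add: bregman_def step_gap_def inner_diff_left inner_diff_right)
qed

text \<open>The vector \<open>p - pstar\<close> splits into \<open>x - xstar\<close> and
  \<open>\<gamma>\<close> times a difference of subgradients of \<open>R\<close>, and monotonicity
  makes the cross term nonnegative. This is how square integrability of \<open>x\<close> is obtained
  from the energy.\<close>

lemma primal_le_energy:
  assumes "x = prox (\<lambda>z. ereal \<gamma> * R z) p"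
  shows "(norm (x - xstar))\<^sup>2 \<le> energy p y"
proof -
  define r where "r = (1 / \<gamma>) *\<^sub>R (p - x) - (- grad F xstar - adjoint L ystar)"
  have "0 \<le> r \<bullet> (x - xstar)"
    unfolding r_def using R(1) prox_R[OF assms] R_subdifferential by (rule subdifferential_monotone)
  moreover have "p - pstar = (x - xstar) + \<gamma> *\<^sub>R r"
    using \<gamma>_pos by (simp add: r_def pstar_def algebra_simps)
  then have "(norm (p - pstar))\<^sup>2
      = (norm (x - xstar))\<^sup>2 + 2 * (\<gamma> * (r \<bullet> (x - xstar))) + (norm (\<gamma> *\<^sub>R r))\<^sup>2"
    unfolding power2_norm_eq_inner by (simp add: inner_add_left inner_add_right inner_commute)
  moreover have "(norm (p - pstar))\<^sup>2 \<le> energy p y"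
    unfolding energy_def using normP_sq_bound[OF linear_L \<gamma>_pos \<tau>_pos step_size, of "(p, y) - (pstar, ystar)"]
    by simp
  ultimately show ?thesis using \<gamma>_pos by (smt (verit) mult_nonneg_nonneg zero_le_power2)
qed

lemma energy_nonneg: "0 \<le> energy p y"
  unfolding energy_def using normP_sq_bound[OF linear_L \<gamma>_pos \<tau>_pos step_size]
  by (meson order_trans zero_le_power2)

text \<open>Subgradient inequalities at \<open>x\<close> and \<open>y'\<close>, directed towards the
  solution, bound the gap. Written in error variables, the bound is the factor in
  \<open>energy_identity\<close> minus a noise term. Two nonnegative terms of the identity are
  dropped: a square and the \<open>P\<close>-norm of the dual increment.\<close>

lemma energy_step:
  assumes x: "x = prox (\<lambda>z. ereal \<gamma> * R z) p"
    and w: "w = 2 *\<^sub>R x - p - \<gamma> *\<^sub>R g"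
    and y': "y' = prox (\<lambda>z. ereal \<tau> * Hc z) (y + \<tau> *\<^sub>R L (w - \<gamma> *\<^sub>R adjoint L y))"
    and p': "p' = x - \<gamma> *\<^sub>R g - \<gamma> *\<^sub>R adjoint L y'"
  shows "energy p' y' + 2 * \<gamma> * step_gap x y'
    \<le> energy p y + \<gamma>\<^sup>2 * (norm (g - grad F xstar))\<^sup>2 - 2 * \<gamma> * ((g - grad F x) \<bullet> (x - xstar))"
proof -
  define gs where "gs = grad F xstar"
  define Ys where "Ys = adjoint L ystar"
  define X where "X = x - xstar"
  define r where "r = (1 / \<gamma>) *\<^sub>R (p - x)"
  \<comment> \<open>This is \<open>r\<close> minus the subgradient of \<open>R\<close> at
    \<open>xstar\<close> provided by the optimality condition.\<close>
  define r' where "r' = r + gs + Ys"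
  define h where "h = (1 / \<tau>) *\<^sub>R (y + \<tau> *\<^sub>R L (w - \<gamma> *\<^sub>R adjoint L y) - y')"
  define G where "G = g - gs"
  define A where "A = adjoint L y - Ys"
  define B where "B = adjoint L y' - Ys"
  have r: "r \<in> subdifferential R x" unfolding r_def by (rule prox_R[OF x])
  have h: "h \<in> subdifferential Hc y'" unfolding h_def by (rule prox_Hc[OF y'])
  have adj: "linear (adjoint L)" by (rule adjoint_linear[OF linear_L])
  have AB: "A = adjoint L (y - ystar)" "B = adjoint L (y' - ystar)"
    by (simp_all add: A_def B_def Ys_def linear_diff[OF adj])
  have p_eq: "p = x + \<gamma> *\<^sub>R r" using \<gamma>_pos by (simp add: r_def)
  have "Rr x - Rr xstar \<le> r \<bullet> X"
    using subgradient_le[OF r R_finite[OF r] R_finite[OF R_subdifferential]]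
    by (simp add: X_def inner_diff_right)
  moreover have "Hr y' - Hr ystar \<le> h \<bullet> (y' - ystar)"
    using subgradient_le[OF h Hc_finite[OF h] Hc_finite[OF L_subdifferential]]
    by (simp add: inner_diff_right)
  moreover have "F x - F xstar \<le> grad F x \<bullet> X"
    using convex_on_grad_le[OF convex_F, of x xstar] smooth_F
    by (simp add: X_def smooth_with_def inner_diff_right)
  moreover have "L x \<bullet> ystar - L xstar \<bullet> y' = Ys \<bullet> X - L xstar \<bullet> (y' - ystar)"
    by (simp add: X_def Ys_def adjoint_L inner_diff_right inner_commute[of "adjoint L ystar"])
  ultimately have gap: "step_gap x y' \<le> (grad F x + r + Ys) \<bullet> X + (h - L xstar) \<bullet> (y' - ystar)"
    by (simp add: step_gap_def inner_add_left inner_diff_left)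
  have "h = (1 / \<tau>) *\<^sub>R (y - y') + L (w - \<gamma> *\<^sub>R adjoint L y)"
    using \<tau>_pos by (simp add: h_def algebra_simps)
  \<comment> \<open>The contributions of \<open>gs\<close> and \<open>Ys\<close> cancel, so the
    argument of \<open>L\<close> is \<open>xstar\<close> plus error terms only.\<close>
  moreover have "w - \<gamma> *\<^sub>R adjoint L y = xstar + (X - \<gamma> *\<^sub>R r' - \<gamma> *\<^sub>R G - \<gamma> *\<^sub>R A)"
    unfolding w p_eq X_def r'_def G_def A_def by (simp add: algebra_simps scaleR_2)
  ultimately have "h - L xstar = (1 / \<tau>) *\<^sub>R (y - y') + L (X - \<gamma> *\<^sub>R r' - \<gamma> *\<^sub>R G - \<gamma> *\<^sub>R A)"
    by (simp only: linear_add[OF linear_L]) simp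
  then have "(h - L xstar) \<bullet> (y' - ystar)
      = 1 / \<tau> * ((y - y') \<bullet> (y' - ystar)) + (X - \<gamma> *\<^sub>R r' - \<gamma> *\<^sub>R G - \<gamma> *\<^sub>R A) \<bullet> B"
    by (simp add: inner_add_left adjoint_L AB(2))
  \<comment> \<open>The tangent inequality for \<open>F\<close> involves the exact gradient, while
    the iteration uses \<open>g\<close>; exchanging them creates the noise term.\<close>
  moreover have "(grad F x + r + Ys) \<bullet> X = (G + r') \<bullet> X - (g - grad F x) \<bullet> X"
    by (simp add: G_def r'_def algebra_simps inner_add_left inner_diff_left)
  ultimately have gap2: "step_gap x y' + (g - grad F x) \<bullet> X
      \<le> (G + r') \<bullet> X + 1 / \<tau> * (((y - ystar) - (y' - ystar)) \<bullet> (y' - ystar))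
        + (X - \<gamma> *\<^sub>R r' - \<gamma> *\<^sub>R G - \<gamma> *\<^sub>R A) \<bullet> B"
    using gap by simp
  have "p - pstar = X + \<gamma> *\<^sub>R r'"
    by (simp add: p_eq pstar_def X_def r'_def gs_def Ys_def algebra_simps)
  then have e: "energy p y = (norm (X + \<gamma> *\<^sub>R r'))\<^sup>2 + \<gamma> / \<tau> * (norm (y - ystar))\<^sup>2 - \<gamma>\<^sup>2 * (norm A)\<^sup>2"
    by (simp add: energy_def normP_sq_def AB)
  have "p' - pstar = X - \<gamma> *\<^sub>R G - \<gamma> *\<^sub>R B"
    by (simp add: p' pstar_def X_def G_def B_def gs_def Ys_def algebra_simps)
  then have e': "energy p' y' = (norm (X - \<gamma> *\<^sub>R G - \<gamma> *\<^sub>R B))\<^sup>2 + \<gamma> / \<tau> * (norm (y' - ystar))\<^sup>2 - \<gamma>\<^sup>2 * (norm B)\<^sup>2"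
    by (simp add: energy_def normP_sq_def AB)
  have "B - A = adjoint L (y' - y)"
    by (simp add: A_def B_def linear_diff[OF adj])
  \<comment> \<open>The bound on the \<open>P\<close>-norm is used for a vector with zero primal
    part.\<close>
  then have "0 \<le> \<gamma> / \<tau> * (norm (y' - y))\<^sup>2 - \<gamma>\<^sup>2 * (norm (B - A))\<^sup>2"
    using normP_sq_bound[OF linear_L \<gamma>_pos \<tau>_pos step_size, of "(0, y' - y)"]
    by (simp add: normP_sq_def)
  moreover have "2 * \<gamma> * (step_gap x y' + (g - grad F x) \<bullet> X)
      \<le> 2 * \<gamma> * ((G + r') \<bullet> X + 1 / \<tau> * (((y - ystar) - (y' - ystar)) \<bullet> (y' - ystar))
        + (X - \<gamma> *\<^sub>R r' - \<gamma> *\<^sub>R G - \<gamma> *\<^sub>R A) \<bullet> B)"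
    using gap2 \<gamma>_pos by (intro mult_left_mono) auto
  moreover have "0 \<le> \<gamma>\<^sup>2 * (norm (r' + B))\<^sup>2" by simp
  moreover have vec: "(y' - ystar) - (y - ystar) = y' - y" by simp
  moreover have "2 * \<gamma> * (step_gap x y' + (g - grad F x) \<bullet> X)
      = 2 * \<gamma> * step_gap x y' + 2 * \<gamma> * ((g - grad F x) \<bullet> X)"
    by (simp add: algebra_simps)
  ultimately show ?thesis
    using energy_identity[of X \<gamma> r' \<tau> "y - ystar" A G B "y' - ystar", unfolded vec] e e'
    unfolding X_def G_def gs_def by linarith
qed

end

section \<open>Expectations\<close>

text \<open>Jensen's inequality is read off from a convex combination of points on the graph, which
  stays in the convex epigraph.\<close>

lemma epi_jensen:
  fixes f :: "'a::real_vector \<Rightarrow> ereal"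
  assumes "convex (epi f)" "finite I" "(\<Sum>i\<in>I. a i) = 1" "\<And>i. i \<in> I \<Longrightarrow> a i \<ge> 0"
    and "\<And>i. i \<in> I \<Longrightarrow> \<bar>f (z i)\<bar> \<noteq> \<infinity>"
  shows "f (\<Sum>i\<in>I. a i *\<^sub>R z i) \<le> ereal (\<Sum>i\<in>I. a i * real_of_ereal (f (z i)))"
proof -
  have "(\<Sum>i\<in>I. a i *\<^sub>R (z i, real_of_ereal (f (z i)))) \<in> epi f"
    using assms by (intro convex_sum) (auto simp: ereal_real)
  moreover have "(\<Sum>i\<in>I. a i *\<^sub>R (z i, real_of_ereal (f (z i))))
      = (\<Sum>i\<in>I. a i *\<^sub>R z i, \<Sum>i\<in>I. a i * real_of_ereal (f (z i)))"
    by (intro prod_eqI) (simp_all add: fst_sum snd_sum)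
  ultimately show ?thesis by simp
qed

section \<open>Integrability and orthogonality from conditional expectations\<close>

context sigma_finite_subalgebra
begin

text \<open>Conditional expectation in \<open>ennreal\<close> preserves the integral even when it is
  infinite. An integrable bound on it therefore yields integrability of \<open>f\<close> itself,
  which is how moments of \<open>g\<close> and \<open>\<sigma>\<close> are obtained.\<close>

lemma integrable_nn_cond_exp_le:
  fixes f u :: "'a \<Rightarrow> real"
  assumes [measurable]: "f \<in> borel_measurable M" and "\<And>\<omega>. f \<omega> \<ge> 0"
    and u: "integrable M u" "AE \<omega> in M. 0 \<le> u \<omega>"
    and le: "AE \<omega> in M. nn_cond_exp M F (\<lambda>\<omega>. ennreal (f \<omega>)) \<omega> \<le> ennreal (u \<omega>)"
  shows "integrable M f" "(\<integral>\<omega>. f \<omega> \<partial>M) \<le> (\<integral>\<omega>. u \<omega> \<partial>M)"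
proof -
  have "(\<integral>\<^sup>+\<omega>. ennreal (f \<omega>) \<partial>M) = (\<integral>\<^sup>+\<omega>. nn_cond_exp M F (\<lambda>\<omega>. ennreal (f \<omega>)) \<omega> \<partial>M)"
    using nn_cond_exp_intg[of "\<lambda>_. 1" "\<lambda>\<omega>. ennreal (f \<omega>)"] by simp
  also have "\<dots> \<le> (\<integral>\<^sup>+\<omega>. ennreal (u \<omega>) \<partial>M)" by (rule nn_integral_mono_AE[OF le])
  also have "\<dots> = ennreal (\<integral>\<omega>. u \<omega> \<partial>M)" by (rule nn_integral_eq_integral[OF u])
  finally have *: "(\<integral>\<^sup>+\<omega>. ennreal (f \<omega>) \<partial>M) \<le> ennreal (\<integral>\<omega>. u \<omega> \<partial>M)" .
  also have "\<dots> < \<infinity>" by simp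
  finally show int: "integrable M f"
    using assms(2) by (intro integrableI_nonneg) auto
  have "0 \<le> (\<integral>\<omega>. u \<omega> \<partial>M)" using u(2) by (rule integral_nonneg_AE)
  then show "(\<integral>\<omega>. f \<omega> \<partial>M) \<le> (\<integral>\<omega>. u \<omega> \<partial>M)"
    using * assms(2) by (simp add: nn_integral_eq_integral[OF int])
qed

text \<open>In each coordinate the factor from \<open>Z\<close> is known to the subalgebra and can
  be pulled out; the products are dominated by the sum of the two squared norms. This makes the
  gradient noise orthogonal to \<open>x - xstar\<close> in mean.\<close>

lemma vec_cond_exp_inner:
  fixes G Z :: "'a \<Rightarrow> 'c::euclidean_space"
  assumes [measurable]: "G \<in> borel_measurable M" "Z \<in> borel_measurable F"
    and int: "integrable M (\<lambda>\<omega>. (norm (G \<omega>))\<^sup>2)" "integrable M (\<lambda>\<omega>. (norm (Z \<omega>))\<^sup>2)"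
  shows "integrable M (\<lambda>\<omega>. G \<omega> \<bullet> Z \<omega>)" "integrable M (\<lambda>\<omega>. vec_cond_exp M F G \<omega> \<bullet> Z \<omega>)"
    "(\<integral>\<omega>. vec_cond_exp M F G \<omega> \<bullet> Z \<omega> \<partial>M) = (\<integral>\<omega>. G \<omega> \<bullet> Z \<omega> \<partial>M)"
proof -
  have [measurable]: "Z \<in> borel_measurable M"
    using measurable_from_subalg[OF subalg] assms(2) by blast
  have i: "integrable M (\<lambda>\<omega>. (Z \<omega> \<bullet> b) * (G \<omega> \<bullet> b))" if b: "b \<in> Basis" for b
  proof (rule Bochner_Integration.integrable_bound)
    show "integrable M (\<lambda>\<omega>. (norm (G \<omega>))\<^sup>2 + (norm (Z \<omega>))\<^sup>2)" using int by simp
    have "\<bar>(Z \<omega> \<bullet> b) * (G \<omega> \<bullet> b)\<bar> \<le> (norm (G \<omega>))\<^sup>2 + (norm (Z \<omega>))\<^sup>2" for \<omega>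
    proof -
      have "\<bar>(Z \<omega> \<bullet> b) * (G \<omega> \<bullet> b)\<bar> \<le> norm (Z \<omega>) * norm (G \<omega>)"
        unfolding abs_mult using b by (intro mult_mono) (auto simp: Basis_le_norm)
      also have "\<dots> \<le> (norm (G \<omega>))\<^sup>2 + (norm (Z \<omega>))\<^sup>2"
        using sum_squares_bound[of "norm (Z \<omega>)" "norm (G \<omega>)"]
          mult_nonneg_nonneg[OF norm_ge_zero[of "Z \<omega>"] norm_ge_zero[of "G \<omega>"]] by linarith
      finally show ?thesis .
    qed
    then show "AE \<omega> in M. norm ((Z \<omega> \<bullet> b) * (G \<omega> \<bullet> b)) \<le> norm ((norm (G \<omega>))\<^sup>2 + (norm (Z \<omega>))\<^sup>2)"
      by (auto intro!: AE_I2)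
  qed simp
  have m: "(\<lambda>\<omega>. Z \<omega> \<bullet> b) \<in> borel_measurable F" "(\<lambda>\<omega>. G \<omega> \<bullet> b) \<in> borel_measurable M" for b
    by simp_all
  note c = real_cond_exp_intg[OF i m]
  have "G \<omega> \<bullet> Z \<omega> = (\<Sum>b\<in>Basis. (Z \<omega> \<bullet> b) * (G \<omega> \<bullet> b))" for \<omega>
    by (subst euclidean_inner) (simp add: mult.commute)
  then have eq: "(\<lambda>\<omega>. G \<omega> \<bullet> Z \<omega>) = (\<lambda>\<omega>. \<Sum>b\<in>Basis. (Z \<omega> \<bullet> b) * (G \<omega> \<bullet> b))" by auto
  have eq': "(\<lambda>\<omega>. vec_cond_exp M F G \<omega> \<bullet> Z \<omega>)
      = (\<lambda>\<omega>. \<Sum>b\<in>Basis. (Z \<omega> \<bullet> b) * real_cond_exp M F (\<lambda>\<omega>. G \<omega> \<bullet> b) \<omega>)"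
    by (intro ext) (simp add: vec_cond_exp_def inner_sum_right inner_commute[of _ "Z _"] mult.commute)
  show "integrable M (\<lambda>\<omega>. G \<omega> \<bullet> Z \<omega>)" "integrable M (\<lambda>\<omega>. vec_cond_exp M F G \<omega> \<bullet> Z \<omega>)"
    unfolding eq eq' using i c(1) by auto
  show "(\<integral>\<omega>. vec_cond_exp M F G \<omega> \<bullet> Z \<omega> \<partial>M) = (\<integral>\<omega>. G \<omega> \<bullet> Z \<omega> \<partial>M)"
    unfolding eq eq' using i c by (simp add: Bochner_Integration.integral_sum)
qed

end

section \<open>The gap at averaged iterates, and measurability of the data\<close>

context pd3o
begin

text \<open>Jensen's inequality first shows that \<open>R\<close> and \<open>Hc\<close> are finite
  at the averages, so the difference of the extended-valued Lagrangians is the real number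
  \<open>step_gap\<close>. Convexity of the gap in the pair gives the last bound.\<close>

lemma step_gap_average:
  assumes "k \<ge> 1" "\<And>j. j < k \<Longrightarrow> \<bar>R (x j)\<bar> \<noteq> \<infinity>" "\<And>j. j < k \<Longrightarrow> \<bar>Hc (y (Suc j))\<bar> \<noteq> \<infinity>"
  defines "xb \<equiv> (1 / real k) *\<^sub>R (\<Sum>j<k. x j)" and "yb \<equiv> (1 / real k) *\<^sub>R (\<Sum>j=1..k. y j)"
  shows "lagrangian F R H L xb ystar - lagrangian F R H L xstar yb = ereal (step_gap xb yb)"
    and "0 \<le> step_gap xb yb"
    and "step_gap xb yb \<le> (1 / real k) * (\<Sum>j<k. step_gap (x j) (y (Suc j)))"
proof -
  have k: "(\<Sum>j<k. 1 / real k) = 1" using assms(1) by simp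
  have xb: "xb = (\<Sum>j<k. (1 / real k) *\<^sub>R x j)" by (simp add: xb_def scaleR_sum_right)
  \<comment> \<open>The shift pairs \<open>x j\<close> with \<open>y (Suc j)\<close>. The initial
    \<open>y 0\<close>, which may lie outside the domain of \<open>Hc\<close>, does not
    occur.\<close>
  have "(\<Sum>j=1..k. y j) = (\<Sum>j<k. y (Suc j))"
    by (rule sum.reindex_bij_witness[of _ Suc "\<lambda>j. j - 1"]) auto
  then have yb: "yb = (\<Sum>j<k. (1 / real k) *\<^sub>R y (Suc j))" by (simp add: yb_def scaleR_sum_right)
  have Rb: "R xb \<le> ereal (\<Sum>j<k. 1 / real k * Rr (x j))"
    unfolding xb using epi_R(2) k assms(2) by (intro epi_jensen) auto
  then have R_fin: "\<bar>R xb\<bar> \<noteq> \<infinity>" using R(1) by (auto simp: proper_def)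
  have Hb: "Hc yb \<le> ereal (\<Sum>j<k. 1 / real k * Hr (y (Suc j)))"
    unfolding yb using Hc(2) k assms(3) by (intro epi_jensen) auto
  then have H_fin: "\<bar>Hc yb\<bar> \<noteq> \<infinity>" using Hc(3) by (auto simp: proper_def)
  have fin: "\<bar>R xstar\<bar> \<noteq> \<infinity>" "\<bar>Hc ystar\<bar> \<noteq> \<infinity>"
    using R_finite[OF R_subdifferential] Hc_finite[OF L_subdifferential] by auto
  show "lagrangian F R H L xb ystar - lagrangian F R H L xstar yb = ereal (step_gap xb yb)"
    using R_fin H_fin fin unfolding lagrangian_def step_gap_def
    by (cases "R xb"; cases "Hc yb"; cases "R xstar"; cases "Hc ystar") auto
  show "0 \<le> step_gap xb yb"
    using bregman_le_step_gap[OF R_fin H_fin] bregman_bounds(1)[OF convex_F smooth_F, of xb xstar]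
    by linarith
  have "F xb \<le> (\<Sum>j<k. 1 / real k * F (x j))"
    unfolding xb using k assms(1) by (intro convex_on_sum[OF _ _ convex_F]) (auto simp: lessThan_empty_iff)
  moreover have "Rr xb \<le> (\<Sum>j<k. 1 / real k * Rr (x j))" using Rb R_fin by (cases "R xb") auto
  moreover have "Hr yb \<le> (\<Sum>j<k. 1 / real k * Hr (y (Suc j)))" using Hb H_fin by (cases "Hc yb") auto
  moreover have "L xb \<bullet> ystar = (\<Sum>j<k. 1 / real k * (L (x j) \<bullet> ystar))"
    unfolding xb by (simp add: linear_sum[OF linear_L] linear_cmul[OF linear_L] inner_sum_left)
  moreover have "L xstar \<bullet> yb = (\<Sum>j<k. 1 / real k * (L xstar \<bullet> y (Suc j)))"
    unfolding yb by (simp add: inner_sum_right)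
  moreover have "(1 / real k) * (\<Sum>j<k. step_gap (x j) (y (Suc j)))
    = (\<Sum>j<k. 1 / real k * F (x j)) - F xstar + ((\<Sum>j<k. 1 / real k * Rr (x j)) - Rr xstar)
      + ((\<Sum>j<k. 1 / real k * Hr (y (Suc j))) - Hr ystar)
      + (\<Sum>j<k. 1 / real k * (L (x j) \<bullet> ystar)) - (\<Sum>j<k. 1 / real k * (L xstar \<bullet> y (Suc j)))"
    using assms(1)
    by (simp add: step_gap_def sum.distrib sum_subtractf flip: sum_divide_distrib)
      (simp add: field_simps)
  ultimately show "step_gap xb yb \<le> (1 / real k) * (\<Sum>j<k. step_gap (x j) (y (Suc j)))"
    unfolding step_gap_def[of xb yb] by linarith
qed

lemma F_differentiable: "F differentiable (at z)"
  using smooth_F by (simp add: smooth_with_def)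

lemma F_measurable [measurable]: "F \<in> borel_measurable borel"
  by (intro borel_measurable_continuous_onI continuous_at_imp_continuous_on ballI
      differentiable_imp_continuous_within F_differentiable)

lemma L_measurable [measurable]: "L \<in> borel_measurable borel"
  and adjoint_measurable [measurable]: "adjoint L \<in> borel_measurable borel"
  using linear_L adjoint_linear[OF linear_L]
  by (auto intro!: borel_measurable_continuous_onI linear_continuous_on
      simp: linear_conv_bounded_linear)

lemma Rr_measurable [measurable]: "Rr \<in> borel_measurable borel"
  and Hr_measurable [measurable]: "Hr \<in> borel_measurable borel"
  using closed_epi_measurable[OF epi_R(1)] closed_epi_measurable[OF Hc(1)] by auto

lemma step_gap_measurable [measurable (raw)]:
  assumes [measurable]: "X \<in> borel_measurable N" "Y \<in> borel_measurable N"
  shows "(\<lambda>\<omega>. step_gap (X \<omega>) (Y \<omega>)) \<in> borel_measurable N"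
  unfolding step_gap_def by measurable

lemma energy_measurable [measurable (raw)]:
  assumes [measurable]: "P \<in> borel_measurable N" "Y \<in> borel_measurable N"
  shows "(\<lambda>\<omega>. energy (P \<omega>) (Y \<omega>)) \<in> borel_measurable N"
  unfolding energy_def normP_sq_def by simp

lemma prox_R_measurable [measurable]: "prox (\<lambda>z. ereal \<gamma> * R z) \<in> borel_measurable borel"
  using \<gamma>_pos epi_R R(1) by (intro prox_measurable closed_epi_cmult convex_epi_cmult proper_cmult)

lemma prox_Hc_measurable [measurable]: "prox (\<lambda>z. ereal \<tau> * Hc z) \<in> borel_measurable borel"
  using \<tau>_pos Hc by (intro prox_measurable closed_epi_cmult convex_epi_cmult proper_cmult)

end

section \<open>The stochastic iteration: adaptedness, expected descent, telescoping\<close>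

locale stochastic_pd3o = pd3o F R H L xstar ystar \<nu> \<gamma> \<tau>
  for F :: "'a::euclidean_space \<Rightarrow> real" and R and H :: "'b::euclidean_space \<Rightarrow> ereal" and L
    and xstar ystar \<nu> \<gamma> \<tau> +
  fixes M :: "'w measure" and \<F> :: "nat \<Rightarrow> 'w measure"
    and x p w g :: "nat \<Rightarrow> 'w \<Rightarrow> 'a" and y :: "nat \<Rightarrow> 'w \<Rightarrow> 'b" and \<sigma> :: "nat \<Rightarrow> 'w \<Rightarrow> real"
    and p0 y0 \<alpha> \<beta> \<delta> \<rho> \<kappa> \<sigma>0
  assumes filtered: "filtered_prob_space M \<F>"
    and iterates: "\<And>\<omega>. \<omega> \<in> space M \<Longrightarrow>
      pd3o_iterates \<gamma> \<tau> R H L p0 y0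
        (\<lambda>k. g k \<omega>) (\<lambda>k. x k \<omega>) (\<lambda>k. w k \<omega>) (\<lambda>k. y k \<omega>) (\<lambda>k. p k \<omega>)"
    and sga: "stochastic_gradient_assumption M \<F> F xstar x g \<sigma> \<alpha> \<beta> \<delta> \<rho>"
    and \<sigma>_init: "\<And>\<omega>. \<omega> \<in> space M \<Longrightarrow> \<sigma> 0 \<omega> = \<sigma>0"
    and \<kappa>: "\<kappa> = \<beta> / \<rho>"
    and \<gamma>_le: "2 * \<gamma> * (\<alpha> + \<kappa> * \<delta>) \<le> 1"
begin

sublocale prob_space M
  using filtered by (simp add: filtered_prob_space_def)

lemma sigma_finite_subalgebra_filtration: "sigma_finite_subalgebra M (\<F> k)"
proof -
  interpret finite_measure_subalgebra M "\<F> k"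
    using filtered
    by (intro finite_measure_subalgebra.intro finite_measure_subalgebra_axioms.intro)
      (auto simp: filtered_prob_space_def intro: finite_measure_axioms)
  show ?thesis by (rule sigma_finite_subalgebra_axioms)
qed

lemma subalg: "subalgebra M (\<F> k)"
  using filtered by (simp add: filtered_prob_space_def)

lemma space_filtration: "space (\<F> k) = space M"
  using subalg by (simp add: subalgebra_def)

lemma iterate_init: "\<omega> \<in> space M \<Longrightarrow> p 0 \<omega> = p0" "\<omega> \<in> space M \<Longrightarrow> y 0 \<omega> = y0"
  and iterate_x: "\<omega> \<in> space M \<Longrightarrow> x k \<omega> = prox (\<lambda>z. ereal \<gamma> * R z) (p k \<omega>)"
  and iterate_w: "\<omega> \<in> space M \<Longrightarrow> w k \<omega> = 2 *\<^sub>R x k \<omega> - p k \<omega> - \<gamma> *\<^sub>R g (Suc k) \<omega>"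
  and iterate_y: "\<omega> \<in> space M \<Longrightarrow> y (Suc k) \<omega>
    = prox (\<lambda>z. ereal \<tau> * Hc z) (y k \<omega> + \<tau> *\<^sub>R L (w k \<omega> - \<gamma> *\<^sub>R adjoint L (y k \<omega>)))"
  and iterate_p: "\<omega> \<in> space M \<Longrightarrow>
    p (Suc k) \<omega> = x k \<omega> - \<gamma> *\<^sub>R g (Suc k) \<omega> - \<gamma> *\<^sub>R adjoint L (y (Suc k) \<omega>)"
  using iterates unfolding pd3o_iterates_def by auto

lemma measurable_mono: "f \<in> borel_measurable (\<F> i) \<Longrightarrow> i \<le> j \<Longrightarrow> f \<in> borel_measurable (\<F> j)"
  using filtered by (intro measurable_from_subalg[of "\<F> j" "\<F> i"])
    (auto simp: filtered_prob_space_def filtration_def subalgebra_def)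

lemma g_measurable: "g k \<in> borel_measurable (\<F> k)"
  and \<sigma>_measurable: "\<sigma> k \<in> borel_measurable (\<F> k)"
  using sga by (auto simp: stochastic_gradient_assumption_def adapted_def)

lemma x_measurable_if:
  assumes [measurable]: "p k \<in> borel_measurable (\<F> k)"
  shows "x k \<in> borel_measurable (\<F> k)"
proof -
  have "(\<lambda>\<omega>. prox (\<lambda>z. ereal \<gamma> * R z) (p k \<omega>)) \<in> borel_measurable (\<F> k)" by measurable
  then show ?thesis
    by (rule measurable_cong[THEN iffD1, rotated]) (simp add: iterate_x space_filtration)
qed

text \<open>Step \<open>k\<close> draws \<open>g (Suc k)\<close>, so \<open>p\<close> and
  \<open>y\<close> are adapted. Hence \<open>x k\<close>, a function of \<open>p k\<close>, is
  already known at time \<open>k\<close>, as the mean-zero argument requires. The recursions hold on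
  \<open>space M\<close> only, hence the congruence steps.\<close>

lemma py_measurable: "p k \<in> borel_measurable (\<F> k) \<and> y k \<in> borel_measurable (\<F> k)"
proof (induction k)
  case 0
  have "p 0 \<in> borel_measurable (\<F> 0) \<longleftrightarrow> (\<lambda>_. p0) \<in> borel_measurable (\<F> 0)"
    "y 0 \<in> borel_measurable (\<F> 0) \<longleftrightarrow> (\<lambda>_. y0) \<in> borel_measurable (\<F> 0)"
    by (rule measurable_cong, simp add: iterate_init space_filtration)+
  then show ?case by simp
next
  case (Suc k)
  note [measurable] = measurable_mono[OF conjunct1[OF Suc] le_SucI[OF order_refl]]
    measurable_mono[OF conjunct2[OF Suc] le_SucI[OF order_refl]]
    measurable_mono[OF x_measurable_if[OF conjunct1[OF Suc]] le_SucI[OF order_refl]]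
    g_measurable[of "Suc k"]
  have "(\<lambda>\<omega>. prox (\<lambda>z. ereal \<tau> * Hc z) (y k \<omega> + \<tau> *\<^sub>R L (2 *\<^sub>R x k \<omega> - p k \<omega> - \<gamma> *\<^sub>R g (Suc k) \<omega>
      - \<gamma> *\<^sub>R adjoint L (y k \<omega>)))) \<in> borel_measurable (\<F> (Suc k))"
    by measurable
  then have y [measurable]: "y (Suc k) \<in> borel_measurable (\<F> (Suc k))"
    by (rule measurable_cong[THEN iffD1, rotated]) (simp add: iterate_y iterate_w space_filtration)
  have "(\<lambda>\<omega>. x k \<omega> - \<gamma> *\<^sub>R g (Suc k) \<omega> - \<gamma> *\<^sub>R adjoint L (y (Suc k) \<omega>)) \<in> borel_measurable (\<F> (Suc k))"
    by measurable
  then have "p (Suc k) \<in> borel_measurable (\<F> (Suc k))"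
    by (rule measurable_cong[THEN iffD1, rotated]) (simp add: iterate_p space_filtration)
  with y show ?case by simp
qed

lemma x_measurable: "x k \<in> borel_measurable (\<F> k)"
  using x_measurable_if py_measurable by blast

lemma measurable_M [measurable]:
  "p k \<in> borel_measurable M" "y k \<in> borel_measurable M" "x k \<in> borel_measurable M"
  "g k \<in> borel_measurable M" "\<sigma> k \<in> borel_measurable M"
  using measurable_from_subalg[OF subalg] py_measurable x_measurable g_measurable \<sigma>_measurable
  by blast+

lemma iterates_finite:
  assumes "\<omega> \<in> space M"
  shows "\<bar>R (x k \<omega>)\<bar> \<noteq> \<infinity>" "\<bar>Hc (y (Suc k) \<omega>)\<bar> \<noteq> \<infinity>"
  using R_finite[OF prox_R[OF iterate_x[OF assms]]] Hc_finite[OF prox_Hc[OF iterate_y[OF assms]]]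
  by auto

lemma constants: "\<alpha> \<ge> 0" "\<beta> \<ge> 0" "\<delta> \<ge> 0" "0 < \<rho>" "\<rho> \<le> 1"
  using sga by (auto simp: stochastic_gradient_assumption_def)

text \<open>Integrability has to be earned before the pointwise inequality may be integrated. It
  goes from the energy to \<open>X\<close> and \<open>D\<close>, then through the conditional bounds
  to \<open>G\<close> and \<open>S'\<close>, then to the noise \<open>C\<close>, and finally by
  domination to \<open>E'\<close> and \<open>T\<close>.\<close>

lemma expectation_step:
  assumes int: "integrable M (\<lambda>\<omega>. energy (p k \<omega>) (y k \<omega>))" "integrable M (\<lambda>\<omega>. (\<sigma> k \<omega>)\<^sup>2)"
  shows "integrable M (\<lambda>\<omega>. energy (p (Suc k) \<omega>) (y (Suc k) \<omega>))"
    "integrable M (\<lambda>\<omega>. (\<sigma> (Suc k) \<omega>)\<^sup>2)"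
    "integrable M (\<lambda>\<omega>. step_gap (x k \<omega>) (y (Suc k) \<omega>))"
    "expectation (\<lambda>\<omega>. energy (p (Suc k) \<omega>) (y (Suc k) \<omega>))
        + \<gamma>\<^sup>2 * \<kappa> * expectation (\<lambda>\<omega>. (\<sigma> (Suc k) \<omega>)\<^sup>2)
        + \<gamma> * expectation (\<lambda>\<omega>. step_gap (x k \<omega>) (y (Suc k) \<omega>))
      \<le> expectation (\<lambda>\<omega>. energy (p k \<omega>) (y k \<omega>)) + \<gamma>\<^sup>2 * \<kappa> * expectation (\<lambda>\<omega>. (\<sigma> k \<omega>)\<^sup>2)"
proof -
  interpret sub: sigma_finite_subalgebra M "\<F> k" by (rule sigma_finite_subalgebra_filtration)
  define X where "X = (\<lambda>\<omega>. x k \<omega> - xstar)"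
  define D where "D = (\<lambda>\<omega>. bregman F (x k \<omega>) xstar)"
  define G where "G = (\<lambda>\<omega>. (norm (g (Suc k) \<omega> - grad F xstar))\<^sup>2)"
  define C where "C = (\<lambda>\<omega>. (g (Suc k) \<omega> - grad F (x k \<omega>)) \<bullet> X \<omega>)"
  define E where "E = (\<lambda>\<omega>. energy (p k \<omega>) (y k \<omega>))"
  define E' where "E' = (\<lambda>\<omega>. energy (p (Suc k) \<omega>) (y (Suc k) \<omega>))"
  define S where "S = (\<lambda>\<omega>. (\<sigma> k \<omega>)\<^sup>2)"
  define S' where "S' = (\<lambda>\<omega>. (\<sigma> (Suc k) \<omega>)\<^sup>2)"
  define T where "T = (\<lambda>\<omega>. step_gap (x k \<omega>) (y (Suc k) \<omega>))"
  note defs = X_def D_def G_def E_def E'_def S_def S'_def T_def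
  have XF: "X \<in> borel_measurable (\<F> k)"
    unfolding X_def using x_measurable[of k] by simp
  have [measurable]: "X \<in> borel_measurable M" "D \<in> borel_measurable M" "G \<in> borel_measurable M"
      "E \<in> borel_measurable M" "E' \<in> borel_measurable M" "S' \<in> borel_measurable M" "T \<in> borel_measurable M"
    unfolding defs bregman_def by measurable
  have E: "integrable M E" and S: "integrable M S" using int by (auto simp: E_def S_def)
  have X2: "integrable M (\<lambda>\<omega>. (norm (X \<omega>))\<^sup>2)"
    using E by (rule Bochner_Integration.integrable_bound)
      (auto simp: X_def E_def energy_nonneg intro!: AE_I2 primal_le_energy iterate_x)
  have D_nonneg: "0 \<le> D \<omega>" for \<omega>
    unfolding D_def by (rule bregman_bounds(1)[OF convex_F smooth_F])
  have D: "integrable M D"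
  proof (rule Bochner_Integration.integrable_bound)
    show "integrable M (\<lambda>\<omega>. \<nu> * (norm (X \<omega>))\<^sup>2)" using X2 by simp
    show "AE \<omega> in M. norm (D \<omega>) \<le> norm (\<nu> * (norm (X \<omega>))\<^sup>2)"
    proof (rule AE_I2)
      fix \<omega> show "norm (D \<omega>) \<le> norm (\<nu> * (norm (X \<omega>))\<^sup>2)"
        using D_nonneg[of \<omega>] bregman_bounds(2)[OF convex_F smooth_F, of "x k \<omega>" xstar]
        unfolding D_def X_def real_norm_def by linarith
    qed
  qed simp
  have G_meas: "G \<in> borel_measurable M" and S'_meas: "S' \<in> borel_measurable M" by measurable
  have nonneg: "0 \<le> G \<omega>" "0 \<le> S' \<omega>" for \<omega> by (simp_all add: G_def S'_def)
  have G_le: "AE \<omega> in M. nn_cond_exp M (\<F> k) (\<lambda>\<omega>. ennreal (G \<omega>)) \<omega> \<le> ennreal (2 * \<alpha> * D \<omega> + \<beta> * S \<omega>)"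
    using sga unfolding stochastic_gradient_assumption_def G_def D_def S_def by blast
  have G_bound: "integrable M (\<lambda>\<omega>. 2 * \<alpha> * D \<omega> + \<beta> * S \<omega>)" using D S by simp
  have "AE \<omega> in M. 0 \<le> 2 * \<alpha> * D \<omega> + \<beta> * S \<omega>"
    using constants D_nonneg by (intro AE_I2) (simp add: S_def)
  note G = sub.integrable_nn_cond_exp_le[OF G_meas nonneg(1) G_bound this G_le]
  have S'_le: "AE \<omega> in M. nn_cond_exp M (\<F> k) (\<lambda>\<omega>. ennreal (S' \<omega>)) \<omega> \<le> ennreal ((1 - \<rho>) * S \<omega> + 2 * \<delta> * D \<omega>)"
    using sga unfolding stochastic_gradient_assumption_def S'_def D_def S_def by blast
  have S'_bound: "integrable M (\<lambda>\<omega>. (1 - \<rho>) * S \<omega> + 2 * \<delta> * D \<omega>)" using D S by simp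
  have "AE \<omega> in M. 0 \<le> (1 - \<rho>) * S \<omega> + 2 * \<delta> * D \<omega>"
    using constants D_nonneg by (intro AE_I2) (simp add: S_def)
  note S' = sub.integrable_nn_cond_exp_le[OF S'_meas nonneg(2) S'_bound this S'_le]
  have g2: "integrable M (\<lambda>\<omega>. (norm (g (Suc k) \<omega>))\<^sup>2)"
  proof (rule Bochner_Integration.integrable_bound)
    show "integrable M (\<lambda>\<omega>. 2 * G \<omega> + 2 * (norm (grad F xstar))\<^sup>2)" using G(1) by simp
    have "(norm (g (Suc k) \<omega>))\<^sup>2 \<le> 2 * G \<omega> + 2 * (norm (grad F xstar))\<^sup>2" for \<omega>
    proof -
      have "norm (g (Suc k) \<omega>) \<le> norm (g (Suc k) \<omega> - grad F xstar) + norm (grad F xstar)"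
        using norm_triangle_ineq[of "g (Suc k) \<omega> - grad F xstar" "grad F xstar"] by simp
      then have "(norm (g (Suc k) \<omega>))\<^sup>2 \<le> (norm (g (Suc k) \<omega> - grad F xstar) + norm (grad F xstar))\<^sup>2"
        by (intro power_mono) auto
      also have "\<dots> \<le> 2 * G \<omega> + 2 * (norm (grad F xstar))\<^sup>2"
        using sum_squares_bound[of "norm (g (Suc k) \<omega> - grad F xstar)" "norm (grad F xstar)"]
        by (simp add: G_def power2_sum)
      finally show ?thesis .
    qed
    then show "AE \<omega> in M. norm ((norm (g (Suc k) \<omega>))\<^sup>2) \<le> norm (2 * G \<omega> + 2 * (norm (grad F xstar))\<^sup>2)"
      by (auto intro!: AE_I2 order_trans[OF _ abs_ge_self])
  qed simp
  have gF: "AE \<omega> in M. vec_cond_exp M (\<F> k) (g (Suc k)) \<omega> = grad F (x k \<omega>)"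
    using sga unfolding stochastic_gradient_assumption_def by blast
  note inner = sub.vec_cond_exp_inner[OF measurable_M(4) XF g2 X2]
  \<comment> \<open>The conditional mean of \<open>g (Suc k)\<close> equals the gradient only almost
    everywhere, so integrability and the value 0 are carried together through an almost-everywhere
    congruence.\<close>
  have C: "has_bochner_integral M C 0"
  proof -
    have "has_bochner_integral M
        (\<lambda>\<omega>. g (Suc k) \<omega> \<bullet> X \<omega> - vec_cond_exp M (\<F> k) (g (Suc k)) \<omega> \<bullet> X \<omega>) 0"
      using inner by (simp add: has_bochner_integral_iff)
    moreover have "AE \<omega> in M. g (Suc k) \<omega> \<bullet> X \<omega> - vec_cond_exp M (\<F> k) (g (Suc k)) \<omega> \<bullet> X \<omega> = C \<omega>"
      using gF by eventually_elim (simp add: C_def inner_diff_left)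
    moreover have "C \<in> borel_measurable M"
    proof -
      have "\<nu>-lipschitz_on UNIV (grad F)" using smooth_F by (simp add: smooth_with_def)
      then have [measurable]: "grad F \<in> borel_measurable borel"
        by (intro borel_measurable_continuous_onI lipschitz_on_continuous_on)
      show ?thesis unfolding C_def by measurable
    qed
    ultimately show ?thesis
      by (subst has_bochner_integral_cong_AE[symmetric]) (auto dest: has_bochner_integral_iff[THEN iffD1] borel_measurable_integrable)
  qed
  then have C: "integrable M C" "expectation C = 0" by (auto simp: has_bochner_integral_iff)
  define U where "U = (\<lambda>\<omega>. E \<omega> + \<gamma>\<^sup>2 * G \<omega> - 2 * \<gamma> * C \<omega>)"
  have U: "integrable M U" unfolding U_def using E G C by simp
  have E'_nonneg: "0 \<le> E' \<omega>" for \<omega> by (simp add: E'_def energy_nonneg)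
  have DT: "D \<omega> \<le> T \<omega>" if "\<omega> \<in> space M" for \<omega>
    unfolding D_def T_def using iterates_finite[OF that] by (rule bregman_le_step_gap)
  have step: "E' \<omega> + 2 * \<gamma> * T \<omega> \<le> U \<omega>" if "\<omega> \<in> space M" for \<omega>
    unfolding E'_def T_def U_def E_def G_def C_def X_def
    by (rule energy_step[OF iterate_x iterate_w iterate_y iterate_p]) (rule that)+
  have T_nonneg: "0 \<le> 2 * \<gamma> * T \<omega>" if "\<omega> \<in> space M" for \<omega>
    using DT[OF that] D_nonneg[of \<omega>] \<gamma>_pos by simp
  \<comment> \<open>Both quantities are nonnegative and their sum is at most \<open>U\<close>, so
    \<open>U\<close> dominates each of them.\<close>
  have le: "norm (E' \<omega>) \<le> norm (U \<omega>)" "norm (2 * \<gamma> * T \<omega>) \<le> norm (U \<omega>)" if "\<omega> \<in> space M" for \<omega>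
    using step[OF that] T_nonneg[OF that] E'_nonneg[of \<omega>] unfolding real_norm_def by linarith+
  have E': "integrable M E'"
    by (rule Bochner_Integration.integrable_bound[OF U]) (measurable, intro AE_I2 le(1))
  have "integrable M (\<lambda>\<omega>. 2 * \<gamma> * T \<omega>)"
    by (rule Bochner_Integration.integrable_bound[OF U]) (measurable, intro AE_I2 le(2))
  then have T: "integrable M T" using \<gamma>_pos by simp
  show "integrable M (\<lambda>\<omega>. energy (p (Suc k) \<omega>) (y (Suc k) \<omega>))"
    "integrable M (\<lambda>\<omega>. (\<sigma> (Suc k) \<omega>)\<^sup>2)"
    "integrable M (\<lambda>\<omega>. step_gap (x k \<omega>) (y (Suc k) \<omega>))"
    using E' S'(1) T by (simp_all add: E'_def S'_def T_def)
  have "expectation (\<lambda>\<omega>. E' \<omega> + 2 * \<gamma> * T \<omega>) \<le> expectation U"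
    using E' T U step by (intro integral_mono) auto
  also have "expectation U = expectation E + \<gamma>\<^sup>2 * expectation G"
    unfolding U_def using E G C by simp
  finally have 1: "expectation E' + 2 * \<gamma> * expectation T \<le> expectation E + \<gamma>\<^sup>2 * expectation G"
    using E' T by simp
  have "\<gamma>\<^sup>2 * expectation G \<le> \<gamma>\<^sup>2 * (2 * \<alpha> * expectation D + \<beta> * expectation S)"
    using G D S by (intro mult_left_mono) auto
  moreover have "\<gamma>\<^sup>2 * \<kappa> * expectation S' \<le> \<gamma>\<^sup>2 * \<kappa> * ((1 - \<rho>) * expectation S + 2 * \<delta> * expectation D)"
    using S' D S constants by (intro mult_left_mono) (auto simp: \<kappa>)
  \<comment> \<open>This is the reason for the choice of \<open>\<kappa>\<close>: the weights
    \<open>\<beta>\<close> and \<open>\<kappa> * (1 - \<rho>)\<close> of the variance term add up to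
    \<open>\<kappa>\<close>.\<close>
  moreover have "\<kappa> * \<rho> = \<beta>" using constants by (simp add: \<kappa>)
  then have "\<gamma>\<^sup>2 * (2 * \<alpha> * expectation D + \<beta> * expectation S)
        + \<gamma>\<^sup>2 * \<kappa> * ((1 - \<rho>) * expectation S + 2 * \<delta> * expectation D)
      = \<gamma>\<^sup>2 * \<kappa> * expectation S + \<gamma> * ((2 * \<gamma> * (\<alpha> + \<kappa> * \<delta>)) * expectation D)"
    by (auto simp: algebra_simps power2_eq_square)
  \<comment> \<open>The step size bound and \<open>D\<close> being at most \<open>T\<close> let one
    of the two copies of \<open>\<gamma> * expectation T\<close> absorb the Bregman terms; the other
    copy survives.\<close>
  moreover have "\<gamma> * ((2 * \<gamma> * (\<alpha> + \<kappa> * \<delta>)) * expectation D) \<le> \<gamma> * (1 * expectation T)"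
  proof (intro mult_left_mono mult_mono \<gamma>_le)
    show "expectation D \<le> expectation T" using D T DT by (intro integral_mono) auto
    show "0 \<le> expectation D" using D_nonneg by simp
  qed (use \<gamma>_pos in auto)
  ultimately have "expectation E' + \<gamma>\<^sup>2 * \<kappa> * expectation S' + \<gamma> * expectation T
      \<le> expectation E + \<gamma>\<^sup>2 * \<kappa> * expectation S"
    using 1 by linarith
  then show "expectation (\<lambda>\<omega>. energy (p (Suc k) \<omega>) (y (Suc k) \<omega>))
        + \<gamma>\<^sup>2 * \<kappa> * expectation (\<lambda>\<omega>. (\<sigma> (Suc k) \<omega>)\<^sup>2)
        + \<gamma> * expectation (\<lambda>\<omega>. step_gap (x k \<omega>) (y (Suc k) \<omega>))
      \<le> expectation (\<lambda>\<omega>. energy (p k \<omega>) (y k \<omega>)) + \<gamma>\<^sup>2 * \<kappa> * expectation (\<lambda>\<omega>. (\<sigma> k \<omega>)\<^sup>2)"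
    unfolding E_def E'_def S_def S'_def T_def .
qed

lemma integrable_energy:
  "integrable M (\<lambda>\<omega>. energy (p k \<omega>) (y k \<omega>)) \<and> integrable M (\<lambda>\<omega>. (\<sigma> k \<omega>)\<^sup>2)"
proof (induction k)
  case 0
  have "integrable M (\<lambda>\<omega>. energy (p 0 \<omega>) (y 0 \<omega>)) \<longleftrightarrow> integrable M (\<lambda>\<omega>. energy p0 y0)"
    by (rule Bochner_Integration.integrable_cong) (auto simp: iterate_init)
  moreover have "integrable M (\<lambda>\<omega>. (\<sigma> 0 \<omega>)\<^sup>2) \<longleftrightarrow> integrable M (\<lambda>\<omega>. \<sigma>0\<^sup>2)"
    by (rule Bochner_Integration.integrable_cong) (auto simp: \<sigma>_init)
  ultimately show ?case by simp
qed (use expectation_step in blast)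

lemma integrable_step_gap: "integrable M (\<lambda>\<omega>. step_gap (x k \<omega>) (y (Suc k) \<omega>))"
  using expectation_step(3) integrable_energy by blast

lemma sum_step_gap_le:
  "expectation (\<lambda>\<omega>. energy (p k \<omega>) (y k \<omega>)) + \<gamma>\<^sup>2 * \<kappa> * expectation (\<lambda>\<omega>. (\<sigma> k \<omega>)\<^sup>2)
    + \<gamma> * (\<Sum>j<k. expectation (\<lambda>\<omega>. step_gap (x j \<omega>) (y (Suc j) \<omega>)))
    \<le> energy p0 y0 + \<gamma>\<^sup>2 * \<kappa> * \<sigma>0\<^sup>2"
proof (induction k)
  case 0
  have "expectation (\<lambda>\<omega>. energy (p 0 \<omega>) (y 0 \<omega>)) = expectation (\<lambda>\<omega>. energy p0 y0)"
    by (rule Bochner_Integration.integral_cong) (auto simp: iterate_init)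
  moreover have "expectation (\<lambda>\<omega>. (\<sigma> 0 \<omega>)\<^sup>2) = expectation (\<lambda>\<omega>. \<sigma>0\<^sup>2)"
    by (rule Bochner_Integration.integral_cong) (auto simp: \<sigma>_init)
  ultimately show ?case by (simp add: prob_space)
next
  case (Suc k)
  show ?case
    using Suc expectation_step(4)[OF conjunct1[OF integrable_energy] conjunct2[OF integrable_energy], of k]
    by (simp add: algebra_simps)
qed

lemma average_gap:
  assumes k: "k \<ge> 1"
  defines "xb \<equiv> \<lambda>\<omega>. (1 / real k) *\<^sub>R (\<Sum>j<k. x j \<omega>)" and "yb \<equiv> \<lambda>\<omega>. (1 / real k) *\<^sub>R (\<Sum>j=1..k. y j \<omega>)"
  shows "integrable M (\<lambda>\<omega>. step_gap (xb \<omega>) (yb \<omega>))"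
    and "expectation (\<lambda>\<omega>. step_gap (xb \<omega>) (yb \<omega>)) \<le> (energy p0 y0 + \<gamma>\<^sup>2 * \<kappa> * \<sigma>0\<^sup>2) / (real k * \<gamma>)"
proof -
  define T where "T = (\<lambda>\<omega>. (1 / real k) * (\<Sum>j<k. step_gap (x j \<omega>) (y (Suc j) \<omega>)))"
  have T: "integrable M T" unfolding T_def using integrable_step_gap by simp
  \<comment> \<open>The gap at the averages lies between 0 and an integrable average of gaps, which
    gives its integrability as well as the bound.\<close>
  have bounds: "0 \<le> step_gap (xb \<omega>) (yb \<omega>)" "step_gap (xb \<omega>) (yb \<omega>) \<le> T \<omega>" if "\<omega> \<in> space M" for \<omega>
    using step_gap_average(2,3)[OF k, of "\<lambda>j. x j \<omega>" "\<lambda>j. y j \<omega>"] iterates_finite[OF that]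
    by (auto simp: xb_def yb_def T_def)
  show int: "integrable M (\<lambda>\<omega>. step_gap (xb \<omega>) (yb \<omega>))"
    using T
  proof (rule Bochner_Integration.integrable_bound)
    show "(\<lambda>\<omega>. step_gap (xb \<omega>) (yb \<omega>)) \<in> borel_measurable M"
      unfolding xb_def yb_def by measurable
    show "AE \<omega> in M. norm (step_gap (xb \<omega>) (yb \<omega>)) \<le> norm (T \<omega>)"
      using bounds by (intro AE_I2) force
  qed
  have "expectation (\<lambda>\<omega>. step_gap (xb \<omega>) (yb \<omega>)) \<le> expectation T"
    using int T bounds(2) by (intro integral_mono) auto
  also have "expectation T = (\<Sum>j<k. expectation (\<lambda>\<omega>. step_gap (x j \<omega>) (y (Suc j) \<omega>))) / real k"
    unfolding T_def using integrable_step_gap by (simp add: Bochner_Integration.integral_sum)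
  also have "\<dots> \<le> (energy p0 y0 + \<gamma>\<^sup>2 * \<kappa> * \<sigma>0\<^sup>2) / (real k * \<gamma>)"
  proof -
    \<comment> \<open>The energy and variance left over after \<open>k\<close> steps are nonnegative
      and are discarded from the telescoped inequality.\<close>
    have "0 \<le> expectation (\<lambda>\<omega>. energy (p k \<omega>) (y k \<omega>))" by (simp add: energy_nonneg)
    moreover have "0 \<le> \<gamma>\<^sup>2 * \<kappa> * expectation (\<lambda>\<omega>. (\<sigma> k \<omega>)\<^sup>2)"
      using constants by (simp add: \<kappa>)
    ultimately have "\<gamma> * (\<Sum>j<k. expectation (\<lambda>\<omega>. step_gap (x j \<omega>) (y (Suc j) \<omega>)))
        \<le> energy p0 y0 + \<gamma>\<^sup>2 * \<kappa> * \<sigma>0\<^sup>2"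
      using sum_step_gap_le[of k] by linarith
    then show ?thesis using k \<gamma>_pos by (simp add: field_simps)
  qed
  finally show "expectation (\<lambda>\<omega>. step_gap (xb \<omega>) (yb \<omega>)) \<le> (energy p0 y0 + \<gamma>\<^sup>2 * \<kappa> * \<sigma>0\<^sup>2) / (real k * \<gamma>)" .
qed

end

theorem theorem5p1:
  fixes F :: "'a::euclidean_space \<Rightarrow> real"
    and R :: "'a \<Rightarrow> ereal"
    and H :: "'b::euclidean_space \<Rightarrow> ereal"
    and L :: "'a \<Rightarrow> 'b"
    and M :: "'w measure"
    and \<F> :: "nat \<Rightarrow> 'w measure"
    and x p w g :: "nat \<Rightarrow> 'w \<Rightarrow> 'a"
    and y :: "nat \<Rightarrow> 'w \<Rightarrow> 'b"
    and \<sigma> :: "nat \<Rightarrow> 'w \<Rightarrow> real"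
    and xstar pstar p0 :: 'a
    and ystar y0 :: 'b
    and \<nu> \<gamma> \<tau> \<alpha> \<beta> \<delta> \<rho> \<kappa> \<sigma>0 V0 :: real
    and xbar :: "nat \<Rightarrow> 'w \<Rightarrow> 'a"
    and ybar :: "nat \<Rightarrow> 'w \<Rightarrow> 'b"
    and gap :: "nat \<Rightarrow> 'w \<Rightarrow> ereal"
  assumes "linear L"
    and "convex_on UNIV F" and "\<nu> > 0" and "smooth_with \<nu> F"
    and "proper R" and "econvex R" and "lsc R"
    and "proper H" and "econvex H" and "lsc H"
    and "primal_dual_solution F R H L xstar ystar"
    and "\<gamma> > 0" and "\<tau> > 0"
    and "filtered_prob_space M \<F>"
    and "\<And>\<omega>. \<omega> \<in> space M \<Longrightarrow>
      pd3o_iterates \<gamma> \<tau> R H L p0 y0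
        (\<lambda>k. g k \<omega>) (\<lambda>k. x k \<omega>) (\<lambda>k. w k \<omega>) (\<lambda>k. y k \<omega>) (\<lambda>k. p k \<omega>)"
    and "stochastic_gradient_assumption M \<F> F xstar x g \<sigma> \<alpha> \<beta> \<delta> \<rho>"
    and "\<And>\<omega>. \<omega> \<in> space M \<Longrightarrow> \<sigma> 0 \<omega> = \<sigma>0"
    and "\<kappa> = \<beta> / \<rho>"
    and "ereal \<gamma> \<le> 1 / ereal (2 * (\<alpha> + \<kappa> * \<delta>))"
    and "\<gamma> * \<tau> * (onorm L)\<^sup>2 < 1"
    and "pstar = xstar - \<gamma> *\<^sub>R grad F xstar - \<gamma> *\<^sub>R adjoint L ystar"
    and "V0 = normP_sq \<gamma> \<tau> L ((p0, y0) - (pstar, ystar)) + \<gamma>\<^sup>2 * \<kappa> * \<sigma>0\<^sup>2"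
    and "\<And>k \<omega>. xbar k \<omega> = (1 / real k) *\<^sub>R (\<Sum>j<k. x j \<omega>)"
    and "\<And>k \<omega>. ybar (Suc k) \<omega> = (1 / real k) *\<^sub>R (\<Sum>j=1..k. y j \<omega>)"
    and "\<And>k \<omega>. gap k \<omega> =
      lagrangian F R H L (xbar k \<omega>) ystar - lagrangian F R H L xstar (ybar (Suc k) \<omega>)"
  shows "\<forall>k\<ge>1.
    (AE \<omega> in M. \<bar>gap k \<omega>\<bar> \<noteq> \<infinity>) \<and>
    integrable M (\<lambda>\<omega>. real_of_ereal (gap k \<omega>)) \<and>
    prob_space.expectation M (\<lambda>\<omega>. real_of_ereal (gap k \<omega>)) \<le> V0 / (real k * \<gamma>)"
proof (intro allI impI)
  have "\<beta> \<ge> 0" "\<delta> \<ge> 0" "\<alpha> \<ge> 0" "0 < \<rho>"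
    using assms(16) by (auto simp: stochastic_gradient_assumption_def)
  then have "0 \<le> \<alpha> + \<kappa> * \<delta>" by (simp add: assms(18))
  \<comment> \<open>If \<open>\<alpha> + \<kappa> * \<delta>\<close> is 0, the quotient in
    \<open>ereal\<close> is infinite and restricts nothing; the product form covers this case
    too.\<close>
  then have \<gamma>_le: "2 * \<gamma> * (\<alpha> + \<kappa> * \<delta>) \<le> 1"
    using assms(19) by (cases "\<alpha> + \<kappa> * \<delta> = 0") (auto simp: field_simps one_ereal_def)
  interpret P: stochastic_pd3o F R H L xstar ystar \<nu> \<gamma> \<tau> M \<F> x p w g y \<sigma> p0 y0 \<alpha> \<beta> \<delta> \<rho> \<kappa> \<sigma>0
    by (intro stochastic_pd3o.intro pd3o.intro stochastic_pd3o_axioms.intro) (fact assms \<gamma>_le)+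
  fix k :: nat assume k: "1 \<le> k"
  \<comment> \<open>On all of \<open>space M\<close> the extended-valued gap is a real number, so no
    value is distorted by \<open>real_of_ereal\<close> in the conclusion.\<close>
  have gap: "gap k \<omega> = ereal (P.step_gap (xbar k \<omega>) (ybar (Suc k) \<omega>))" if "\<omega> \<in> space M" for \<omega>
    unfolding assms(25) assms(23,24)
    using P.iterates_finite[OF that] by (intro P.step_gap_average(1)[OF k])
  have V0: "V0 = P.energy p0 y0 + \<gamma>\<^sup>2 * \<kappa> * \<sigma>0\<^sup>2"
    by (simp add: assms(21,22) P.energy_def P.pstar_def)
  have "AE \<omega> in M. \<bar>gap k \<omega>\<bar> \<noteq> \<infinity>"
    using gap by (intro AE_I2) simp
  moreover have "integrable M (\<lambda>\<omega>. real_of_ereal (gap k \<omega>))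
      \<longleftrightarrow> integrable M (\<lambda>\<omega>. P.step_gap (xbar k \<omega>) (ybar (Suc k) \<omega>))"
    by (rule Bochner_Integration.integrable_cong) (simp_all add: gap)
  moreover have "P.expectation (\<lambda>\<omega>. real_of_ereal (gap k \<omega>))
      = P.expectation (\<lambda>\<omega>. P.step_gap (xbar k \<omega>) (ybar (Suc k) \<omega>))"
    by (rule Bochner_Integration.integral_cong) (simp_all add: gap)
  ultimately show "(AE \<omega> in M. \<bar>gap k \<omega>\<bar> \<noteq> \<infinity>) \<and>
    integrable M (\<lambda>\<omega>. real_of_ereal (gap k \<omega>)) \<and>
    P.expectation (\<lambda>\<omega>. real_of_ereal (gap k \<omega>)) \<le> V0 / (real k * \<gamma>)"
    using P.average_gap[OF k] by (simp add: assms(23,24) V0)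
qed

end
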